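(* Let $p>2$ be a prime and let $n>2$ be an integer. Let $P$ be a $p$-group of maximal class of order $p^n$, and let $\mathcal{M}(P)$ be the Schur multiplier of $P$. Then $\mathcal{M}(P)$ has exponent at most $p^k$, where $k$ is the least integer greater than or equal to $(n-2)/(p-1)$.
   Context: A finite $p$-group of order $p^n$ is said to be of maximal class if its nilpotency class is $n-1$. The exponent of a finite group $G$ is the least positive integer $e$ such that $g^e=1$ for all $g\in G$. The Schur multiplier $\mathcal{M}(P)$ of a finite group $P$ is the second integral homology group $H_2(P,\mathbb{Z})$; equivalently, if $P\cong F/R$ with $F$ a free group and $R$ a normal subgroup of $F$, then $\mathcal{M}(P)\cong (R\cap [F,F])/[R,F]$. *)

theory Defs
  imports
    Complex_Main
    "HOL-Algebra.Generated_Groups"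
    "HOL-Algebra.Free_Abelian_Groups"
    "HOL-Computational_Algebra.Primes"
begin

section \<open>Nilpotency class and groups of maximal class\<close>

text \<open>The index is shifted by one: \<open>lower_central G i\<close> is the usual \<open>\<gamma>\<close> with index \<open>i + 1\<close>.
  The commutator convention is the one of \<^const>\<open>derived\<close>.\<close>

fun lower_central :: "('a, 'b) monoid_scheme \<Rightarrow> nat \<Rightarrow> 'a set" where
  "lower_central G 0 = carrier G"
| "lower_central G (Suc i) =
     generate G (\<Union>x \<in> lower_central G i. \<Union>y \<in> carrier G.
       {x \<otimes>\<^bsub>G\<^esub> y \<otimes>\<^bsub>G\<^esub> inv\<^bsub>G\<^esub> x \<otimes>\<^bsub>G\<^esub> inv\<^bsub>G\<^esub> y})"

definition nilpotent :: "('a, 'b) monoid_scheme \<Rightarrow> bool" where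
  "nilpotent G \<longleftrightarrow> (\<exists>c. lower_central G c = {\<one>\<^bsub>G\<^esub>})"

text \<open>Unspecified unless \<open>nilpotent G\<close>.\<close>

definition nilpotency_class :: "('a, 'b) monoid_scheme \<Rightarrow> nat" where
  "nilpotency_class G = (LEAST c. lower_central G c = {\<one>\<^bsub>G\<^esub>})"

text \<open>A finite \<open>p\<close>-group is automatically nilpotent; that conjunct only records that
  \<^const>\<open>nilpotency_class\<close> is well defined here.\<close>

definition maximal_class_group :: "nat \<Rightarrow> nat \<Rightarrow> ('a, 'b) monoid_scheme \<Rightarrow> bool" where
  "maximal_class_group p n G \<longleftrightarrow>
     group G \<and> order G = p ^ n \<and> nilpotent G \<and> nilpotency_class G = n - 1"


section \<open>Exponent\<close>

text \<open>Unspecified if no positive integer annihilates \<open>G\<close>, which cannot happen for finite \<open>G\<close>.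
  In particular a bound on the exponent is only provable when the exponent exists.\<close>

definition group_exponent :: "('a, 'b) monoid_scheme \<Rightarrow> nat" where
  "group_exponent G =
     (LEAST e. 0 < e \<and> (\<forall>g \<in> carrier G. g [^]\<^bsub>G\<^esub> e = \<one>\<^bsub>G\<^esub>))"


section \<open>Integral group homology and the Schur multiplier\<close>

text \<open>The homology of a group \<open>G\<close> with trivial integer coefficients is computed from the
  (inhomogeneous, unnormalised) bar complex: in degree \<open>n\<close> it is the free Abelian group on the
  symbols \<open>[g1|...|gn]\<close>, encoded as lists of length \<open>n\<close> over \<open>carrier G\<close>, and the boundary is
  \<open>[g2|...|gn] + (\<Sum> 0 < i < n. (-1)^i [g1|...|g(i) g(i+1)|...|gn]) + (-1)^n [g1|...|g(n-1)]\<close>.\<close>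

definition bar_chain_group ::
    "('a, 'b) monoid_scheme \<Rightarrow> nat \<Rightarrow> ('a list \<Rightarrow>\<^sub>0 int) monoid" where
  "bar_chain_group G n = free_Abelian_group {xs. length xs = n \<and> set xs \<subseteq> carrier G}"

definition bar_face :: "('a, 'b) monoid_scheme \<Rightarrow> nat \<Rightarrow> 'a list \<Rightarrow> 'a list" where
  "bar_face G i xs =
     (if i = 0 then tl xs
      else if i = length xs then butlast xs
      else take (i - 1) xs @ (xs ! (i - 1) \<otimes>\<^bsub>G\<^esub> xs ! i) # drop (i + 1) xs)"

text \<open>The exceptional case \<open>[]\<close> makes the boundary vanish in degree \<open>0\<close>.\<close>

definition bar_boundary ::
    "('a, 'b) monoid_scheme \<Rightarrow> ('a list \<Rightarrow>\<^sub>0 int) \<Rightarrow> ('a list \<Rightarrow>\<^sub>0 int)" where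
  "bar_boundary G =
     frag_extend (\<lambda>xs. if xs = [] then 0
       else \<Sum>i \<le> length xs. frag_cmul ((-1) ^ i) (frag_of (bar_face G i xs)))"

lemma bar_boundary_1: "bar_boundary G (frag_of [g]) = 0"
  by (simp add: bar_boundary_def bar_face_def frag_cmul_minus_one)

lemma bar_boundary_2:
  "bar_boundary G (frag_of [g, h]) = frag_of [h] - frag_of [g \<otimes>\<^bsub>G\<^esub> h] + frag_of [g]"
  by (simp add: bar_boundary_def bar_face_def numeral_2_eq_2)

lemma bar_boundary_3:
  "bar_boundary G (frag_of [g, h, k]) =
     frag_of [h, k] - frag_of [g \<otimes>\<^bsub>G\<^esub> h, k] + frag_of [g, h \<otimes>\<^bsub>G\<^esub> k] - frag_of [g, h]"
  by (simp add: bar_boundary_def bar_face_def numeral_3_eq_3)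

definition bar_cycles :: "('a, 'b) monoid_scheme \<Rightarrow> nat \<Rightarrow> ('a list \<Rightarrow>\<^sub>0 int) set" where
  "bar_cycles G n = {c \<in> carrier (bar_chain_group G n). bar_boundary G c = 0}"

definition bar_boundaries :: "('a, 'b) monoid_scheme \<Rightarrow> nat \<Rightarrow> ('a list \<Rightarrow>\<^sub>0 int) set" where
  "bar_boundaries G n = bar_boundary G ` carrier (bar_chain_group G (Suc n))"

definition integral_homology_group ::
    "('a, 'b) monoid_scheme \<Rightarrow> nat \<Rightarrow> ('a list \<Rightarrow>\<^sub>0 int) set monoid" where
  "integral_homology_group G n =
     subgroup_generated (bar_chain_group G n) (bar_cycles G n) Mod bar_boundaries G n"

definition schur_multiplier ::
    "('a, 'b) monoid_scheme \<Rightarrow> ('a list \<Rightarrow>\<^sub>0 int) set monoid" where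
  "schur_multiplier G = integral_homology_group G 2"

end

theory Submission
  imports Defs "HOL-Algebra.Multiplicative_Group"
begin

text \<open>
  Write \<open>P = E / A\<close> with \<open>A\<close> central. It is enough to kill \<open>A \<inter> [E, E]\<close>, because for the extension
  by the universal 2-cocycle every 2-cycle of the bar complex lands in the derived subgroup.

  A \<^emph>\<open>uniform\<close> element \<open>s\<close> of \<open>P\<close>, one that centralizes no section \<open>\<gamma> j / \<gamma> (j + 2)\<close>, has
  \<open>s\<^sup>p\<close> central and is conjugate to \<open>s u\<close> for every \<open>u \<in> \<gamma> 2\<close>, so \<open>(s u)\<^sup>p = s\<^sup>p\<close>. Hall's
  collection formula turns this into \<open>u\<^sup>p \<in> \<gamma> m\<close> whenever \<open>u \<in> \<gamma> r\<close>, \<open>r \<ge> 2\<close> and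
  \<open>r \<ge> m - p + 1\<close>. For \<open>b \<in> \<gamma> r\<close> in \<open>E\<close> the power \<open>b\<^sup>p\<close> is then central modulo \<open>\<gamma> (m + 1)\<close>, and
  comparing \<open>b\<^sup>p\<close> with the power of a conjugate of \<open>b\<close> gives \<open>v\<^sup>p \<in> \<gamma> (m + 1)\<close> for \<open>v \<in> \<gamma> (r + 1)\<close>.
  Descending in steps of \<open>p - 1\<close> costs one factor \<open>p\<close> per step. The last step costs no extra factor,
  since elements of \<open>[E, E]\<close> that vanish in \<open>\<gamma> 2 / \<gamma> 3\<close> of \<open>P\<close> already lie in \<open>\<gamma> 3\<close> of \<open>E\<close>.

  Uniform elements exist by counting: a two-step centralizer that differs from all earlier ones occurs
  only at an even index (by the Hall--Witt identity) and only up to \<open>2 p\<close> (by computing \<open>p\<close>-th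
  powers in an abelian section), so \<open>p\<close> proper subgroups cover all of them.
\<close>

section \<open>Commutators and polynomial sequences\<close>

context group
begin

text \<open>With this convention \<open>x\<close> conjugated by \<open>y\<close> is
  \<open>x \<otimes> cm x y\<close>. The commutator in \<open>lower_central\<close> arises by
  inverting both arguments, so the generated subgroups agree.\<close>

definition cm :: "'a \<Rightarrow> 'a \<Rightarrow> 'a" where
  "cm x y = inv x \<otimes> inv y \<otimes> x \<otimes> y"

lemma inv_cancel_left [simp]:
  "x \<in> carrier G \<Longrightarrow> y \<in> carrier G \<Longrightarrow> inv x \<otimes> (x \<otimes> y) = y"
  "x \<in> carrier G \<Longrightarrow> y \<in> carrier G \<Longrightarrow> x \<otimes> (inv x \<otimes> y) = y"
  by (simp_all flip: m_assoc)

lemmas word_simps = m_assoc inv_mult_group cm_def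

lemma cm_closed [simp, intro]: "x \<in> carrier G \<Longrightarrow> y \<in> carrier G \<Longrightarrow> cm x y \<in> carrier G"
  by (simp add: cm_def)

lemma inv_cm: "x \<in> carrier G \<Longrightarrow> y \<in> carrier G \<Longrightarrow> inv (cm x y) = cm y x"
  by (simp add: word_simps)

lemma cm_eq_one_iff:
  assumes "x \<in> carrier G" "y \<in> carrier G"
  shows "cm x y = \<one> \<longleftrightarrow> x \<otimes> y = y \<otimes> x"
proof -
  have "cm x y = inv (y \<otimes> x) \<otimes> (x \<otimes> y)" using assms by (simp add: word_simps)
  then show ?thesis using assms by (metis inv_closed inv_inv inv_solve_left' l_inv m_closed r_one)
qed

lemma conj_eq_cm: "x \<in> carrier G \<Longrightarrow> y \<in> carrier G \<Longrightarrow> inv y \<otimes> x \<otimes> y = x \<otimes> cm x y"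
  by (simp add: word_simps)

lemma hall_witt:
  assumes "x \<in> carrier G" "y \<in> carrier G" "z \<in> carrier G"
  shows "cm (cm x y) (inv x \<otimes> z \<otimes> x) \<otimes> cm (cm z x) (inv z \<otimes> y \<otimes> z)
           \<otimes> cm (cm y z) (inv y \<otimes> x \<otimes> y) = \<one>"
  using assms by (simp add: word_simps)

lemma cm_mult_left:
  "\<lbrakk>x \<in> carrier G; y \<in> carrier G; z \<in> carrier G\<rbrakk> \<Longrightarrow>
     cm (x \<otimes> y) z = inv y \<otimes> cm x z \<otimes> y \<otimes> cm y z"
  by (simp add: word_simps)

lemma cm_inv_left:
  "\<lbrakk>x \<in> carrier G; z \<in> carrier G\<rbrakk> \<Longrightarrow> cm (inv x) z = x \<otimes> inv (cm x z) \<otimes> inv x"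
  by (simp add: word_simps)

lemma subgroup_pow_closed: "subgroup H G \<Longrightarrow> x \<in> H \<Longrightarrow> x [^] (n::nat) \<in> H"
  by (induction n) (auto simp: subgroup.one_closed subgroup.m_closed)

lemma conj_pow:
  "x \<in> carrier G \<Longrightarrow> y \<in> carrier G \<Longrightarrow> (inv y \<otimes> x \<otimes> y) [^] (n::nat) = inv y \<otimes> x [^] n \<otimes> y"
  by (induction n) (simp_all add: word_simps)

text \<open>A noncommutative Newton expansion: binomial polynomials in \<open>m\<close> are
  exponents of the coefficients \<open>a i\<close>, with the factors in a fixed order.\<close>

primrec taylor :: "(nat \<Rightarrow> 'a) \<Rightarrow> nat \<Rightarrow> nat \<Rightarrow> 'a" where
  "taylor a m 0 = a 0"
| "taylor a m (Suc n) = taylor a m n \<otimes> a (Suc n) [^] (m choose Suc n)"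

lemma taylor_cong: "(\<And>i. i \<le> n \<Longrightarrow> a i = b i) \<Longrightarrow> taylor a m n = taylor b m n"
  by (induction n) auto

lemma taylor_carrier:
  "(\<And>i. i \<le> n \<Longrightarrow> a i \<in> carrier G) \<Longrightarrow> taylor a m n \<in> carrier G"
  by (induction n) auto

text \<open>The prime \<open>p\<close> divides the inner binomial coefficients, so each factor with
  index from 2 to \<open>p - 1\<close> is a power of some \<open>a i [^] p\<close>. These factors
  are adjacent and multiply up to \<open>h\<close> without reordering.\<close>

lemma taylor_prime:
  assumes p: "prime p" and H: "subgroup H G"
    and a: "\<And>i. i \<le> p \<Longrightarrow> a i \<in> carrier G"
    and pow: "\<And>i. 2 \<le> i \<Longrightarrow> i < p \<Longrightarrow> a i [^] p \<in> H"
  obtains h where "h \<in> H" "taylor a p p = a 0 \<otimes> a 1 [^] p \<otimes> h \<otimes> a p"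
proof -
  have p2: "2 \<le> p" using p prime_ge_2_nat by blast
  have "\<exists>h\<in>H. taylor a p n = a 0 \<otimes> a 1 [^] p \<otimes> h" if "1 \<le> n" "n < p" for n
    using that
  proof (induction n rule: nat_induct_at_least)
    case base
    show ?case using subgroup.one_closed[OF H] a p2 by (intro bexI[of _ \<one>]) (auto simp: numeral_2_eq_2)
  next
    case (Suc n)
    then obtain h where h: "h \<in> H" "taylor a p n = a 0 \<otimes> a 1 [^] p \<otimes> h" by auto
    have "p dvd (p choose Suc n)" using Suc p by (intro dvd_choose_prime) auto
    then obtain q where q: "p choose Suc n = p * q" by auto
    have "(a (Suc n) [^] p) [^] q \<in> H"
      using pow[of "Suc n"] Suc by (intro subgroup_pow_closed[OF H, of "a (Suc n) [^] p"]) auto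
    then have x: "a (Suc n) [^] (p choose Suc n) \<in> H" using a[of "Suc n"] Suc by (simp add: q nat_pow_pow)
    then show ?case using h H a p2 Suc
      by (intro bexI[of _ "h \<otimes> a (Suc n) [^] (p choose Suc n)"])
        (auto simp: m_assoc subgroup.m_closed subgroup.mem_carrier)
  qed
  from this[of "p - 1"] p2 have "\<exists>h\<in>H. taylor a p (p - 1) = a 0 \<otimes> a 1 [^] p \<otimes> h" by linarith
  then obtain h where h: "h \<in> H" "taylor a p (p - 1) = a 0 \<otimes> a 1 [^] p \<otimes> h" by auto
  have "taylor a p p = taylor a p (p - 1) \<otimes> a p"
    using p2 a[of p] by (cases p) auto
  with h that show ?thesis by auto
qed

end

section \<open>Filtrations and polynomial sequences in groups\<close>

locale filtered_group = group +
  fixes L :: "nat \<Rightarrow> 'a set"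
  assumes subgroup_L: "subgroup (L i) G"
    and L_Suc: "L (Suc i) \<subseteq> L i"
    and L_cm: "\<lbrakk>x \<in> L i; y \<in> L j\<rbrakk> \<Longrightarrow> cm x y \<in> L (i + j)"
begin

lemma L_antimono: "i \<le> j \<Longrightarrow> L j \<subseteq> L i"
  by (rule lift_Suc_antimono_le) (rule L_Suc)

lemma L_antimonoD: "x \<in> L j \<Longrightarrow> i \<le> j \<Longrightarrow> x \<in> L i"
  using L_antimono by blast

lemma L_carrier [simp, intro]: "x \<in> L i \<Longrightarrow> x \<in> carrier G"
  using subgroup.mem_carrier[OF subgroup_L] by blast

lemma L_mult: "x \<in> L i \<Longrightarrow> y \<in> L i \<Longrightarrow> x \<otimes> y \<in> L i"
  by (rule subgroup.m_closed[OF subgroup_L])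

lemma L_inv: "x \<in> L i \<Longrightarrow> inv x \<in> L i"
  by (rule subgroup.m_inv_closed[OF subgroup_L])

lemma L_one [simp]: "\<one> \<in> L i"
  by (rule subgroup.one_closed[OF subgroup_L])

lemma L_pow: "x \<in> L i \<Longrightarrow> x [^] (n::nat) \<in> L i"
  by (rule subgroup_pow_closed[OF subgroup_L])

definition diff :: "(nat \<Rightarrow> 'a) \<Rightarrow> nat \<Rightarrow> 'a" where
  "diff f m = inv (f m) \<otimes> f (Suc m)"

text \<open>Polynomial sequences in the sense of Leibman satisfy this for all \<open>k\<close>. The
  parameter \<open>d\<close> shifts the filtration: the i-th difference has to lie in
  \<open>L (d + i)\<close>.\<close>

primrec poly :: "nat \<Rightarrow> nat \<Rightarrow> (nat \<Rightarrow> 'a) \<Rightarrow> bool" where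
  "poly 0 d f \<longleftrightarrow> (\<forall>m. f m \<in> L d)"
| "poly (Suc k) d f \<longleftrightarrow> (\<forall>m. f m \<in> L d) \<and> poly k (Suc d) (diff f)"

lemma poly_value: "poly k d f \<Longrightarrow> f m \<in> L d"
  by (cases k) auto

lemma poly_cong: "(\<And>m. f m = g m) \<Longrightarrow> poly k d g \<Longrightarrow> poly k d f"
  by (simp add: ext[of f g])

lemma poly_weaken: "poly k (Suc d) f \<Longrightarrow> poly k d f"
  using L_Suc by (induction k arbitrary: d f) (simp_all, blast+)

lemma poly_le: "poly k d f \<Longrightarrow> e \<le> d \<Longrightarrow> poly k e f"
  by (induction d) (auto simp: le_Suc_eq dest: poly_weaken)

lemma poly_SucD: "poly (Suc k) d f \<Longrightarrow> poly k d f"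
  by (induction k arbitrary: d f) auto

text \<open>
  The Lazard--Leibman theorem. Bounding the number \<open>k\<close> of differences is what makes the induction
  go through: the difference of \<open>[f, g]\<close> involves \<open>[f, g]\<close> itself, but only at level \<open>k\<close>.
\<close>

lemma poly_operations:
  "(\<forall>d f g. poly k d f \<longrightarrow> poly k d g \<longrightarrow> poly k d (\<lambda>m. f m \<otimes> g m)) \<and>
   (\<forall>d f. poly k d f \<longrightarrow> poly k d (\<lambda>m. inv (f m))) \<and>
   (\<forall>d e f g. poly k d f \<longrightarrow> poly k e g \<longrightarrow> poly k (d + e) (\<lambda>m. cm (f m) (g m)))"
proof (induction k)
  case 0
  show ?case by (auto intro: L_mult L_inv L_cm)
next
  case (Suc k)
  then have mult: "\<And>d f g. poly k d f \<Longrightarrow> poly k d g \<Longrightarrow> poly k d (\<lambda>m. f m \<otimes> g m)"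
    and inv: "\<And>d f. poly k d f \<Longrightarrow> poly k d (\<lambda>m. inv (f m))"
    and cm: "\<And>d e f g. poly k d f \<Longrightarrow> poly k e g \<Longrightarrow> poly k (d + e) (\<lambda>m. cm (f m) (g m))"
    by blast+
  have cm_le: "poly k c (\<lambda>m. cm (f m) (g m))" if "poly k d f" "poly k e g" "c \<le> d + e" for c d e f g
    using cm[OF that(1,2)] that(3) by (rule poly_le)
  have step: "f (Suc m) = f m \<otimes> diff f m" if "poly j d f" for f m d j
    using L_carrier[OF poly_value[OF that]] by (simp add: diff_def)
  have dcl: "diff f m \<in> carrier G" if "poly j d f" for f m d j
    using poly_value[OF that] unfolding diff_def by (meson L_carrier inv_closed m_closed)
  have pcl: "f m \<in> carrier G" if "poly j d f" for f m d j
    using poly_value[OF that] by blast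
  show ?case
  proof (intro conjI allI impI)
    fix d f g assume f: "poly (Suc k) d f" and g: "poly (Suc k) d g"
    have f': "poly k (Suc d) (diff f)" and g': "poly k (Suc d) (diff g)" using f g by auto
    have "diff (\<lambda>m. f m \<otimes> g m) = (\<lambda>m. (diff f m \<otimes> cm (diff f m) (g m)) \<otimes> diff g m)"
      using f g by (auto simp: fun_eq_iff diff_def word_simps pcl[OF f] pcl[OF g])
    moreover have "poly k (Suc d) (\<lambda>m. (diff f m \<otimes> cm (diff f m) (g m)) \<otimes> diff g m)"
      by (intro mult f' g' cm_le[OF f' poly_SucD[OF g]]) simp
    ultimately show "poly (Suc k) d (\<lambda>m. f m \<otimes> g m)"
      using poly_value[OF f] poly_value[OF g] by (simp add: L_mult)
  next
    fix d f assume f: "poly (Suc k) d f"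
    have f': "poly k (Suc d) (diff f)" using f by auto
    have "diff (\<lambda>m. inv (f m)) = (\<lambda>m. inv (diff f m) \<otimes> cm (inv (diff f m)) (inv (f m)))"
      by (auto simp: fun_eq_iff diff_def word_simps pcl[OF f])
    moreover have "poly k (Suc d) (\<lambda>m. inv (diff f m) \<otimes> cm (inv (diff f m)) (inv (f m)))"
      by (intro mult inv f' cm_le[OF inv[OF f'] inv[OF poly_SucD[OF f]]]) simp
    ultimately show "poly (Suc k) d (\<lambda>m. inv (f m))"
      using poly_value[OF f] by (simp add: L_inv)
  next
    fix d e f g assume f: "poly (Suc k) d f" and g: "poly (Suc k) e g"
    have f0: "poly k d f" and g0: "poly k e g" using f g poly_SucD by auto
    have f': "poly k (Suc d) (diff f)" and g': "poly k (Suc e) (diff g)" using f g by auto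
    \<comment> \<open>With \<open>f'\<close> and \<open>g'\<close> the differences,
      \<open>v = [f f', g']\<close> and \<open>cw = [f f', g]\<close>. Since
      \<open>[f f', g g']\<close> is \<open>v\<close> times the conjugate of \<open>cw\<close> by
      \<open>g'\<close>, the difference of \<open>c\<close> is \<open>v [v, c] w [cw, g']\<close>,
      with all factors one level deeper.\<close>
    define c where "c m = cm (f m) (g m)" for m
    define x where "x m = cm (f m) (diff g m)" for m
    define xf where "xf m = cm (x m) (diff f m)" for m
    define y where "y m = cm (diff f m) (diff g m)" for m
    define v where "v m = x m \<otimes> xf m \<otimes> y m" for m
    define w where "w m = cm (c m) (diff f m) \<otimes> cm (diff f m) (g m)" for m
    define cw where "cw m = c m \<otimes> w m" for m
    have pc: "poly k (d + e) c" unfolding c_def by (rule cm[OF f0 g0])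
    have px: "poly k (Suc (d + e)) x" unfolding x_def by (rule cm_le[OF f0 g']) simp
    have pxf: "poly k (Suc (d + e)) xf" unfolding xf_def by (rule cm_le[OF px f']) simp
    have py: "poly k (Suc (d + e)) y" unfolding y_def by (rule cm_le[OF f' g']) simp
    have pv: "poly k (Suc (d + e)) v" unfolding v_def by (intro mult px pxf py)
    have pw: "poly k (Suc (d + e)) w" unfolding w_def
      by (intro mult cm_le[OF pc f'] cm_le[OF f' g0]) auto
    have pcw: "poly k (d + e) cw" unfolding cw_def by (intro mult pc poly_weaken[OF pw])
    have "poly k (Suc (d + e)) (\<lambda>m. (v m \<otimes> cm (v m) (c m)) \<otimes> (w m \<otimes> cm (cw m) (diff g m)))"
      by (intro mult pv pw cm_le[OF pv pc] cm_le[OF pcw g']) auto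
    moreover have "diff c m = (v m \<otimes> cm (v m) (c m)) \<otimes> (w m \<otimes> cm (cw m) (diff g m))" for m
    proof -
      have cl: "f m \<in> carrier G" "g m \<in> carrier G" "diff f m \<in> carrier G" "diff g m \<in> carrier G"
        using pcl[OF f] pcl[OF g] dcl[OF f] dcl[OF g] by auto
      have cl2: "x m \<in> carrier G" "v m \<in> carrier G" "c m \<in> carrier G" "w m \<in> carrier G" "cw m \<in> carrier G"
        using pcl[OF px] pcl[OF pv] pcl[OF pc] pcl[OF pw] pcl[OF pcw] by auto
      have v: "v m = inv (diff f m) \<otimes> cm (f m) (diff g m) \<otimes> diff f m \<otimes> cm (diff f m) (diff g m)"
        unfolding v_def xf_def y_def using cl cl2 by (simp add: x_def flip: conj_eq_cm)
      have cw: "cw m = inv (diff f m) \<otimes> cm (f m) (g m) \<otimes> diff f m \<otimes> cm (diff f m) (g m)"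
      proof -
        have "cw m = (c m \<otimes> cm (c m) (diff f m)) \<otimes> cm (diff f m) (g m)"
          unfolding cw_def w_def using cl cl2 by (simp add: m_assoc)
        then show ?thesis using cl cl2 by (simp add: c_def flip: conj_eq_cm)
      qed
      have vc: "v m \<otimes> cm (v m) (c m) = inv (c m) \<otimes> v m \<otimes> c m"
        using cl2 by (simp flip: conj_eq_cm)
      have "(v m \<otimes> cm (v m) (c m)) \<otimes> (w m \<otimes> cm (cw m) (diff g m))
          = (inv (c m) \<otimes> v m \<otimes> c m) \<otimes> (inv (c m) \<otimes> (cw m \<otimes> cm (cw m) (diff g m)))"
        unfolding vc using cl cl2 by (simp add: m_assoc cw_def)
      also have "\<dots> = inv (c m) \<otimes> v m \<otimes> (inv (diff g m) \<otimes> cw m \<otimes> diff g m)"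
        using cl cl2 by (simp add: m_assoc flip: conj_eq_cm)
      also have "\<dots> = inv (c m) \<otimes> cm (f m \<otimes> diff f m) (g m \<otimes> diff g m)"
        unfolding v cw using cl by (simp add: c_def word_simps)
      finally show ?thesis
        unfolding diff_def[of c] by (simp add: c_def step[OF f] step[OF g])
    qed
    ultimately have "poly k (Suc (d + e)) (diff c)" by (rule poly_cong[rotated])
    then show "poly (Suc k) (d + e) (\<lambda>m. cm (f m) (g m))"
      using poly_value[OF pc] unfolding c_def[symmetric] by simp
  qed
qed

lemma poly_mult: "poly k d f \<Longrightarrow> poly k d g \<Longrightarrow> poly k d (\<lambda>m. f m \<otimes> g m)"
  and poly_inv: "poly k d f \<Longrightarrow> poly k d (\<lambda>m. inv (f m))"
  and poly_cm: "poly k d f \<Longrightarrow> poly k e g \<Longrightarrow> poly k (d + e) (\<lambda>m. cm (f m) (g m))"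
  using poly_operations[of k] by blast+

text \<open>By Pascal's rule the difference of \<open>a [^] (m choose i)\<close> has exponent
  \<open>m choose (i - 1)\<close>. One unit moves from \<open>i\<close> to \<open>d\<close>, and
  \<open>d + i\<close> stays fixed.\<close>

lemma poly_binomial: "a \<in> L (d + i) \<Longrightarrow> poly k d (\<lambda>m. a [^] (m choose i))"
proof (induction k arbitrary: d i a)
  case 0
  then show ?case using L_antimonoD[OF 0 le_add1] by (simp add: L_pow)
next
  case (Suc k)
  have a: "a \<in> L d" using Suc.prems L_antimonoD by auto
  have "poly k (Suc d) (diff (\<lambda>m. a [^] (m choose i)))"
  proof (cases i)
    case 0
    have "diff (\<lambda>m. a [^] (m choose i)) = (\<lambda>m. \<one> [^] (m choose 0))"
      using a 0 by (auto simp: diff_def fun_eq_iff)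
    then show ?thesis using Suc.IH[of \<one> "Suc d" 0] by simp
  next
    case (Suc i')
    have "diff (\<lambda>m. a [^] (m choose i)) = (\<lambda>m. a [^] (m choose i'))"
    proof
      fix m
      have "a [^] (Suc m choose i) = a [^] (m choose i) \<otimes> a [^] (m choose i')"
        using a Suc by (simp add: nat_pow_mult add.commute)
      then show "diff (\<lambda>m. a [^] (m choose i)) m = a [^] (m choose i')"
        using a by (simp add: diff_def L_carrier)
    qed
    then show ?thesis using Suc.IH[of a "Suc d" i'] Suc.prems Suc by simp
  qed
  with a show ?case by (simp add: L_pow)
qed

lemma poly_const: "a \<in> L d \<Longrightarrow> poly k d (\<lambda>m. a)"
  using poly_binomial[of a d 0 k] by simp

lemma poly_taylor: "(\<And>i. i \<le> n \<Longrightarrow> a i \<in> L (d + i)) \<Longrightarrow> poly k d (\<lambda>m. taylor a m n)"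
  by (induction n) (auto intro!: poly_mult poly_binomial poly_const)

text \<open>If \<open>f\<close> is trivial at \<open>0, ..., n\<close>, its difference is trivial at
  \<open>0, ..., n - 1\<close> and equals \<open>f (Suc n)\<close> at \<open>n\<close>, so each
  induction step gains one level.\<close>

lemma poly_vanish:
  "poly (Suc n) d f \<Longrightarrow> (\<And>i. i \<le> n \<Longrightarrow> f i = \<one>) \<Longrightarrow> f (Suc n) \<in> L (Suc (d + n))"
proof (induction n arbitrary: d f)
  case 0
  then have "diff f 0 \<in> L (Suc d)" by simp
  moreover have "diff f 0 = f 1" using 0(2)[of 0] L_carrier[OF poly_value[OF 0(1)]] by (simp add: diff_def)
  ultimately show ?case by simp
next
  case (Suc n)
  have cl: "f m \<in> carrier G" for m using poly_value[OF Suc.prems(1)] by blast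
  have "diff f (Suc n) \<in> L (Suc (Suc d + n))"
  proof (rule Suc.IH)
    show "poly (Suc n) (Suc d) (diff f)" using Suc.prems(1) by simp
    show "diff f i = \<one>" if "i \<le> n" for i using that Suc.prems(2) by (simp add: diff_def)
  qed
  moreover have "diff f (Suc n) = f (Suc (Suc n))" using Suc.prems(2)[of "Suc n"] cl by (simp add: diff_def)
  ultimately show ?case by simp
qed

text \<open>The coefficients are found one by one. Dividing \<open>f\<close> by the partial product
  gives a sequence trivial at \<open>0, ..., n\<close>. Its value at \<open>n + 1\<close> is the
  next coefficient, deep enough by \<open>poly_vanish\<close>, and enters earlier values with
  exponent 0.\<close>

lemma taylor_expansion:
  assumes "\<And>k. poly k d f"
  obtains a where "\<And>i. i \<le> n \<Longrightarrow> a i \<in> L (d + i)" "\<And>m. m \<le> n \<Longrightarrow> f m = taylor a m n"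
proof -
  have cl: "f m \<in> carrier G" for m using poly_value[OF assms] by blast
  have "\<exists>a. (\<forall>i\<le>n. a i \<in> L (d + i)) \<and> (\<forall>m\<le>n. f m = taylor a m n)"
  proof (induction n)
    case 0
    show ?case using poly_value[OF assms, of 0] by (intro exI[of _ "\<lambda>i. f 0"]) auto
  next
    case (Suc n)
    then obtain a where a: "\<And>i. i \<le> n \<Longrightarrow> a i \<in> L (d + i)" "\<And>m. m \<le> n \<Longrightarrow> f m = taylor a m n"
      by blast
    define h where "h m = inv (taylor a m n) \<otimes> f m" for m
    have ph: "poly k d h" for k unfolding h_def by (intro poly_mult poly_inv poly_taylor a assms)
    have tcl: "taylor a m n \<in> carrier G" for m using poly_value[OF poly_taylor[OF a(1)]] by blast
    have "h i = \<one>" if "i \<le> n" for i using a(2)[OF that] cl tcl by (simp add: h_def)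
    then have h: "h (Suc n) \<in> L (Suc (d + n))" by (rule poly_vanish[OF ph])
    define b where "b = a(Suc n := h (Suc n))"
    have bS: "b (Suc n) = h (Suc n)" by (simp add: b_def)
    have tb: "taylor b m n = taylor a m n" for m by (rule taylor_cong) (simp add: b_def)
    have "f m = taylor b m (Suc n)" if "m \<le> Suc n" for m
    proof (cases "m = Suc n")
      case True
      then show ?thesis using tcl cl by (simp add: tb bS h_def)
    next
      case False
      then show ?thesis using that a(2)[of m] tcl[of m] by (simp add: tb binomial_eq_0)
    qed
    moreover have "b i \<in> L (d + i)" if "i \<le> Suc n" for i using that a(1) h by (simp add: b_def)
    ultimately show ?case by blast
  qed
  then show ?thesis using that by blast
qed

lemma poly_pow: "x \<in> L 1 \<Longrightarrow> poly k 0 (\<lambda>m. x [^] m)"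
  using poly_binomial[of x 0 1 k] by simp

text \<open>
  A form of Hall's collection formula: the Taylor coefficients of the sequence
  \<open>m \<mapsto> x\<^sup>-\<^sup>m (x u)\<^sup>m\<close> lie in \<open>L r, L (r + 1), \<dots>\<close>, and all of them except the first and
  the last enter its value at \<open>p\<close> with an exponent divisible by \<open>p\<close>.
\<close>

theorem pow_prime_mult:
  assumes p: "prime p" and r: "1 \<le> r" and x: "x \<in> L 1" and u: "u \<in> L r"
    and H: "subgroup H G" and pow: "\<And>w. w \<in> L (Suc r) \<Longrightarrow> w [^] p \<in> H"
    and sub: "L (r + p - 1) \<subseteq> H"
  obtains h where "h \<in> H" "(x \<otimes> u) [^] p = x [^] p \<otimes> u [^] p \<otimes> h"
proof -
  have p2: "2 \<le> p" using p prime_ge_2_nat by blast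
  have u1: "u \<in> L 1" using u r by (rule L_antimonoD)
  have cl [simp]: "x \<in> carrier G" "u \<in> carrier G" using x u by auto
  define y where "y = x \<otimes> u"
  have y: "y \<in> L 1" and ycl [simp]: "y \<in> carrier G" unfolding y_def using x u1 L_mult by auto
  define f where "f m = inv (x [^] m) \<otimes> y [^] m" for m :: nat
  have "diff f = (\<lambda>m. u \<otimes> cm u (y [^] m))"
  proof
    fix m :: nat
    have "x [^] m \<otimes> x = x \<otimes> x [^] m" "y [^] m \<otimes> y = y \<otimes> y [^] m"
      using nat_pow_Suc2[OF cl(1), of m] nat_pow_Suc2[OF ycl, of m] by simp_all
    then have "diff f m = inv (y [^] m) \<otimes> inv x \<otimes> y \<otimes> y [^] m"
      by (simp add: diff_def f_def word_simps)
    then show "diff f m = u \<otimes> cm u (y [^] m)"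
      by (simp add: y_def m_assoc flip: conj_eq_cm)
  qed
  moreover have "poly k r (\<lambda>m. u \<otimes> cm u (y [^] m))" for k
    using poly_cm[OF poly_const[OF u] poly_pow[OF y]] by (intro poly_mult poly_const u) simp
  ultimately have df: "poly k r (diff f)" for k by simp
  have f0: "f 0 = \<one>" by (simp add: f_def)
  have fv: "f m \<in> L r" for m
  proof (induction m)
    case (Suc m)
    have "f (Suc m) = f m \<otimes> diff f m" by (simp add: diff_def f_def)
    then show ?case using Suc poly_value[OF df] L_mult by simp
  qed (simp add: f0)
  \<comment> \<open>Although \<open>f\<close> takes values in \<open>L r\<close>, it is treated at
    level \<open>r - 1\<close>, because its first difference is only known to have level
    \<open>r\<close>. This puts \<open>a 1\<close> in \<open>L r\<close> and \<open>a p\<close> in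
    \<open>L (r + p - 1)\<close>.\<close>
  have "poly k (r - 1) f" for k
    using fv df[of "k - 1"] r L_antimonoD[OF fv, of "r - 1"] by (cases k) auto
  then obtain a where a: "\<And>i. i \<le> p \<Longrightarrow> a i \<in> L (r - 1 + i)" "\<And>m. m \<le> p \<Longrightarrow> f m = taylor a m p"
    by (rule taylor_expansion[where n = p]) blast
  have acl: "i \<le> p \<Longrightarrow> a i \<in> carrier G" for i using a(1) by blast
  have t: "taylor a m n = taylor a m m" if "m \<le> n" "n \<le> p" for m n
    using that by (induction n rule: dec_induct)
      (use acl in \<open>auto simp: binomial_eq_0 intro!: r_one taylor_carrier\<close>)
  have a0: "a 0 = \<one>" using a(2)[of 0] t[of 0 p] f0 by simp
  have a1: "a 1 = u" using a(2)[of 1] t[of 1 p] p2 acl[of 1] a0 by (simp add: f_def y_def)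
  have apow: "a i [^] p \<in> H" if "2 \<le> i" "i < p" for i
    using a(1)[of i] that r by (intro pow L_antimonoD[of _ "r - 1 + i" "Suc r"]) auto
  obtain h where h: "h \<in> H" "taylor a p p = a 0 \<otimes> a 1 [^] p \<otimes> h \<otimes> a p"
    by (rule taylor_prime[OF p H, of a, OF acl apow])
  have "a p \<in> H" using a(1)[of p] sub r by auto
  then have hH: "h \<otimes> a p \<in> H" and hcl: "h \<in> carrier G" "a p \<in> carrier G"
    using h H by (auto simp: subgroup.m_closed subgroup.mem_carrier)
  have "y [^] p = x [^] p \<otimes> f p" by (simp add: f_def)
  also have "f p = u [^] p \<otimes> (h \<otimes> a p)" using a(2)[of p] h hcl by (simp add: a0 a1[simplified] m_assoc)
  finally show ?thesis using that[OF hH] hcl by (simp add: y_def m_assoc)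
qed

end

section \<open>The lower central series\<close>

context group
begin

text \<open>Expanding a commutator of a product or an inverse in the first argument yields products
  of conjugates of commutators or their inverses, which stay in the normal subgroup
  \<open>N\<close>. Later commutator inclusions are checked on generators with the help of such
  subgroups.\<close>

lemma subgroup_cm_left:
  assumes N: "N \<lhd> G" and T: "T \<subseteq> carrier G"
  shows "subgroup {w \<in> carrier G. \<forall>a\<in>T. cm w a \<in> N} G"
proof -
  interpret N: normal N G by fact
  show ?thesis
  proof (rule subgroupI)
    show "{w \<in> carrier G. \<forall>a\<in>T. cm w a \<in> N} \<noteq> {}"
      using T by (auto simp: cm_def subset_eq intro!: exI[of _ \<one>])
    fix a assume "a \<in> {w \<in> carrier G. \<forall>a\<in>T. cm w a \<in> N}"
    then show "inv a \<in> {w \<in> carrier G. \<forall>a\<in>T. cm w a \<in> N}"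
      using T N.inv_op_closed2[of a] by (auto simp: cm_inv_left subset_eq)
    fix b assume "b \<in> {w \<in> carrier G. \<forall>a\<in>T. cm w a \<in> N}"
    with \<open>a \<in> _\<close> show "a \<otimes> b \<in> {w \<in> carrier G. \<forall>a\<in>T. cm w a \<in> N}"
      using T N.inv_op_closed1[of b] by (auto simp: cm_mult_left subset_eq)
  qed auto
qed

lemma cm_swap: "subgroup N G \<Longrightarrow> x \<in> carrier G \<Longrightarrow> y \<in> carrier G \<Longrightarrow> cm x y \<in> N \<Longrightarrow> cm y x \<in> N"
  by (metis inv_cm subgroup.m_inv_closed)

declare lower_central.simps(2) [simp del]

lemma normal_lower_central: "lower_central G i \<lhd> G"
proof (induction i)
  case 0
  show ?case using normal_self by simp
next
  case (Suc i)
  interpret N: normal "lower_central G i" G by (rule Suc)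
  show ?case
    unfolding lower_central.simps
  proof (rule normal_generateI)
    fix h g
    assume "h \<in> (\<Union>x\<in>lower_central G i. \<Union>y\<in>carrier G. {x \<otimes> y \<otimes> inv x \<otimes> inv y})" and g: "g \<in> carrier G"
    then obtain x y where xy: "x \<in> lower_central G i" "y \<in> carrier G" "h = x \<otimes> y \<otimes> inv x \<otimes> inv y"
      by auto
    have "g \<otimes> h \<otimes> inv g = (g \<otimes> x \<otimes> inv g) \<otimes> (g \<otimes> y \<otimes> inv g) \<otimes> inv (g \<otimes> x \<otimes> inv g) \<otimes> inv (g \<otimes> y \<otimes> inv g)"
      using xy g N.mem_carrier by (simp add: word_simps)
    moreover have "g \<otimes> x \<otimes> inv g \<in> lower_central G i" using xy g N.inv_op_closed2 by simp
    moreover have "g \<otimes> y \<otimes> inv g \<in> carrier G" using xy g by simp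
    ultimately show "g \<otimes> h \<otimes> inv g \<in> (\<Union>x\<in>lower_central G i. \<Union>y\<in>carrier G. {x \<otimes> y \<otimes> inv x \<otimes> inv y})"
      by blast
  qed (use N.mem_carrier in auto)
qed

lemma subgroup_lower_central: "subgroup (lower_central G i) G"
  by (rule normal_imp_subgroup[OF normal_lower_central])

lemma lower_central_carrier: "x \<in> lower_central G i \<Longrightarrow> x \<in> carrier G"
  by (rule subgroup.mem_carrier[OF subgroup_lower_central])

lemma lower_central_conj:
  assumes "x \<in> lower_central G i" "g \<in> carrier G"
  shows "g \<otimes> x \<otimes> inv g \<in> lower_central G i" "inv g \<otimes> x \<otimes> g \<in> lower_central G i"
  by (rule normal.inv_op_closed2[OF normal_lower_central assms(2,1)],
      rule normal.inv_op_closed1[OF normal_lower_central assms(2,1)])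

lemma lower_central_mult: "x \<in> lower_central G i \<Longrightarrow> y \<in> lower_central G i \<Longrightarrow> x \<otimes> y \<in> lower_central G i"
  and lower_central_inv: "x \<in> lower_central G i \<Longrightarrow> inv x \<in> lower_central G i"
  by (rule subgroup.m_closed[OF subgroup_lower_central], assumption+,
      rule subgroup.m_inv_closed[OF subgroup_lower_central])

lemma lower_central_Suc_minimal:
  assumes "subgroup H G" "\<And>x y. x \<in> lower_central G i \<Longrightarrow> y \<in> carrier G \<Longrightarrow> cm x y \<in> H"
  shows "lower_central G (Suc i) \<subseteq> H"
  unfolding lower_central.simps
proof (rule generate_subgroup_incl[OF _ assms(1)], safe)
  fix x y assume "x \<in> lower_central G i" "y \<in> carrier G"
  then have "cm (inv x) (inv y) \<in> H" "x \<in> carrier G"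
    using assms(2) subgroup.m_inv_closed[OF subgroup_lower_central] lower_central_carrier by auto
  then show "x \<otimes> y \<otimes> inv x \<otimes> inv y \<in> H" using \<open>y \<in> carrier G\<close> by (simp add: cm_def)
qed

lemma cm_lower_central_Suc:
  assumes "x \<in> lower_central G i" "y \<in> carrier G"
  shows "cm x y \<in> lower_central G (Suc i)"
proof -
  have "inv x \<in> lower_central G i" "x \<in> carrier G"
    using assms subgroup.m_inv_closed[OF subgroup_lower_central] lower_central_carrier by auto
  then show ?thesis
    using assms unfolding lower_central.simps cm_def
    by (intro generate.incl UN_I[of "inv x"] UN_I[of "inv y"]) auto
qed

lemma lower_central_Suc_subset: "lower_central G (Suc i) \<subseteq> lower_central G i"
proof (rule lower_central_Suc_minimal[OF subgroup_lower_central])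
  fix x y assume x: "x \<in> lower_central G i" and y: "y \<in> carrier G"
  have "inv x \<otimes> (inv y \<otimes> x \<otimes> y) \<in> lower_central G i"
    by (intro lower_central_mult lower_central_inv lower_central_conj x y)
  then show "cm x y \<in> lower_central G i"
    using lower_central_carrier[OF x] y by (simp add: cm_def m_assoc)
qed

text \<open>The three subgroups argument: the inductive hypothesis for \<open>j\<close>, used at
  \<open>i\<close> and \<open>i + 1\<close>, puts two of the three Hall--Witt factors into the
  target, hence also the third.\<close>

lemma cm_lower_central:
  "x \<in> lower_central G i \<Longrightarrow> y \<in> lower_central G j \<Longrightarrow> cm x y \<in> lower_central G (Suc (i + j))"
proof (induction j arbitrary: i x y)
  case 0
  then show ?case using cm_lower_central_Suc by simp
next
  case (Suc j)
  let ?N = "lower_central G (Suc (i + Suc j))" and ?T = "lower_central G i"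
  let ?H = "{w \<in> carrier G. \<forall>a\<in>?T. cm w a \<in> ?N}"
  have "cm y z \<in> ?H" if y: "y \<in> lower_central G j" and z: "z \<in> carrier G" for y z
  proof (intro CollectI conjI ballI)
    show "cm y z \<in> carrier G" using y z lower_central_carrier by blast
    fix a assume a: "a \<in> ?T"
    have ycl: "y \<in> carrier G" and acl: "a \<in> carrier G" using y a lower_central_carrier by blast+
    \<comment> \<open>This conjugate is chosen so that the inner conjugation by \<open>y\<close> in
      the Hall--Witt identity returns exactly \<open>a\<close>.\<close>
    define x where "x = y \<otimes> a \<otimes> inv y"
    have x: "x \<in> ?T" unfolding x_def by (rule lower_central_conj(1)[OF a ycl])
    have xcl: "x \<in> carrier G" by (rule lower_central_carrier[OF x])
    have 1: "cm (cm x y) (inv x \<otimes> z \<otimes> x) \<in> ?N"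
      using cm_lower_central_Suc[OF Suc.IH[OF x y], of "inv x \<otimes> z \<otimes> x"] z xcl by simp
    have "cm z x \<in> lower_central G (Suc i)"
      by (rule cm_swap[OF subgroup_lower_central xcl z cm_lower_central_Suc[OF x z]])
    moreover have "inv z \<otimes> y \<otimes> z \<in> lower_central G j" by (rule lower_central_conj(2)[OF y z])
    ultimately have 2: "cm (cm z x) (inv z \<otimes> y \<otimes> z) \<in> ?N" using Suc.IH by fastforce
    have "inv (cm (cm y z) (inv y \<otimes> x \<otimes> y))
        = cm (cm x y) (inv x \<otimes> z \<otimes> x) \<otimes> cm (cm z x) (inv z \<otimes> y \<otimes> z)"
      using hall_witt[OF xcl ycl z] xcl ycl z by (intro inv_equality) auto
    then have "inv (cm (cm y z) (inv y \<otimes> x \<otimes> y)) \<in> ?N" using lower_central_mult 1 2 by metis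
    then have "cm (cm y z) (inv y \<otimes> x \<otimes> y) \<in> ?N"
      using lower_central_inv[of "inv (cm (cm y z) (inv y \<otimes> x \<otimes> y))"] xcl ycl z by simp
    moreover have "inv y \<otimes> x \<otimes> y = a" unfolding x_def using ycl acl by (simp add: m_assoc)
    ultimately show "cm (cm y z) a \<in> ?N" by simp
  qed
  then have "lower_central G (Suc j) \<subseteq> ?H"
    by (intro lower_central_Suc_minimal subgroup_cm_left normal_lower_central) (auto dest: lower_central_carrier)
  then have "cm y x \<in> ?N" using Suc.prems by auto
  then show ?case
    using Suc.prems by (intro cm_swap[OF subgroup_lower_central, of y x]) (auto dest: lower_central_carrier)
qed

lemma filtered_lower_central: "filtered_group G (\<lambda>i. lower_central G (i - 1))"
proof (intro filtered_group.intro filtered_group_axioms.intro is_group, goal_cases)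
  case (1 i)
  show ?case by (rule subgroup_lower_central)
next
  case (2 i)
  show ?case using lower_central_Suc_subset[of "i - 1"] by (cases i) auto
next
  case (3 x i y j)
  show ?case
  proof (cases "i = 0 \<or> j = 0")
    case False
    then show ?thesis using cm_lower_central[OF 3] by (cases i; cases j) auto
  next
    case True
    have cl: "x \<in> carrier G" "y \<in> carrier G" using 3 lower_central_carrier by auto
    have "cm x y \<in> lower_central G (i - 1)" "cm x y \<in> lower_central G (j - 1)"
      using cm_lower_central_Suc[OF 3(1) cl(2)] cm_swap[OF subgroup_lower_central cl(2,1) cm_lower_central_Suc[OF 3(2) cl(1)]]
        lower_central_Suc_subset by blast+
    with True show ?thesis by auto
  qed
qed

end

section \<open>The lower central filtration and congruences modulo its terms\<close>

text \<open>
  Truncated subtraction gives \<open>\<gamma> 0 = \<gamma> 1 = G\<close>, so that \<open>[\<gamma> i, \<gamma> j] \<subseteq> \<gamma> (i + j)\<close> holds for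
  all indices.
\<close>

definition (in group) \<gamma> :: "nat \<Rightarrow> 'a set" where
  "\<gamma> i = lower_central G (i - 1)"

locale central_series = group

sublocale central_series \<subseteq> filtered_group G \<gamma>
  using filtered_lower_central unfolding \<gamma>_def[abs_def] .

context central_series
begin

lemma \<gamma>_0 [simp]: "\<gamma> 0 = carrier G" and \<gamma>_1 [simp]: "\<gamma> (Suc 0) = carrier G"
  by (simp_all add: \<gamma>_def)

lemma normal_\<gamma>: "\<gamma> i \<lhd> G"
  unfolding \<gamma>_def by (rule normal_lower_central)

lemma cm_\<gamma>: "x \<in> \<gamma> i \<Longrightarrow> y \<in> carrier G \<Longrightarrow> cm x y \<in> \<gamma> (Suc i)"
  using L_cm[of x i y 1] by simp

lemma cm_\<gamma>': "x \<in> \<gamma> i \<Longrightarrow> y \<in> carrier G \<Longrightarrow> cm y x \<in> \<gamma> (Suc i)"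
  using L_cm[of y 1 x i] by simp

lemma L_cm_le: "x \<in> \<gamma> i \<Longrightarrow> y \<in> \<gamma> j \<Longrightarrow> k \<le> i + j \<Longrightarrow> cm x y \<in> \<gamma> k"
  using L_cm L_antimonoD by blast

lemma \<gamma>_Suc_minimal:
  "\<lbrakk>subgroup H G; 1 \<le> i; \<And>x y. x \<in> \<gamma> i \<Longrightarrow> y \<in> carrier G \<Longrightarrow> cm x y \<in> H\<rbrakk> \<Longrightarrow> \<gamma> (Suc i) \<subseteq> H"
  using lower_central_Suc_minimal[of H "i - 1"] by (simp add: \<gamma>_def)

lemma \<gamma>_conj: "x \<in> \<gamma> i \<Longrightarrow> g \<in> carrier G \<Longrightarrow> inv g \<otimes> x \<otimes> g \<in> \<gamma> i"
  unfolding \<gamma>_def by (rule lower_central_conj)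

text \<open>The preimage of the centralizer of the image of \<open>T\<close> in the quotient by
  \<open>\<gamma> k\<close>.\<close>

definition cmod :: "nat \<Rightarrow> 'a set \<Rightarrow> 'a set" where
  "cmod k T = {w \<in> carrier G. \<forall>a\<in>T. cm w a \<in> \<gamma> k}"

lemma subgroup_cmod: "T \<subseteq> carrier G \<Longrightarrow> subgroup (cmod k T) G"
  unfolding cmod_def by (rule subgroup_cm_left[OF normal_\<gamma>])

lemma cm_\<gamma>_swap: "x \<in> carrier G \<Longrightarrow> y \<in> carrier G \<Longrightarrow> cm x y \<in> \<gamma> k \<Longrightarrow> cm y x \<in> \<gamma> k"
  by (rule cm_swap[OF subgroup_L])

text \<open>Conjugation multiplies \<open>x\<close> by \<open>cm x y\<close>, which commutes with
  \<open>a\<close> modulo \<open>\<gamma> k\<close>. This removes the inner conjugations from the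
  Hall--Witt identity.\<close>

lemma cm_conj_iff:
  assumes "a \<in> carrier G" "x \<in> carrier G" "y \<in> carrier G" "cm a (cm x y) \<in> \<gamma> k"
  shows "cm a (inv y \<otimes> x \<otimes> y) \<in> \<gamma> k \<longleftrightarrow> cm a x \<in> \<gamma> k"
proof -
  have S: "subgroup (cmod k {a}) G" using assms(1) by (intro subgroup_cmod) simp
  have d: "cm x y \<in> cmod k {a}" using assms by (auto simp: cmod_def intro: cm_\<gamma>_swap)
  have iff: "cm a z \<in> \<gamma> k \<longleftrightarrow> z \<in> cmod k {a}" if "z \<in> carrier G" for z
    using that assms(1) by (auto simp: cmod_def intro: cm_\<gamma>_swap)
  have e: "inv y \<otimes> x \<otimes> y = x \<otimes> cm x y" "x = (inv y \<otimes> x \<otimes> y) \<otimes> inv (cm x y)"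
    using assms by (simp_all add: word_simps)
  have "inv y \<otimes> x \<otimes> y \<in> cmod k {a} \<longleftrightarrow> x \<in> cmod k {a}"
    using subgroup.m_closed[OF S] subgroup.m_inv_closed[OF S] d e by metis
  then show ?thesis using assms by (simp add: iff)
qed

text \<open>The double commutators have weight \<open>i + k + 1\<close>. Dropping the inner
  conjugations costs commutators of weight at least \<open>i + k + 2\<close>, since \<open>i\<close>
  and \<open>k\<close> are positive.\<close>

lemma hall_witt_mod:
  assumes x: "x \<in> \<gamma> i" and y: "y \<in> \<gamma> k" and z: "z \<in> carrier G" and "1 \<le> i" "1 \<le> k"
    and 1: "cm (cm x y) z \<in> \<gamma> (Suc (Suc (i + k)))" and 2: "cm (cm z x) y \<in> \<gamma> (Suc (Suc (i + k)))"
  shows "cm (cm y z) x \<in> \<gamma> (Suc (Suc (i + k)))"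
proof -
  have cl [simp]: "x \<in> carrier G" "y \<in> carrier G" "z \<in> carrier G" using x y z by auto
  have xy: "cm x y \<in> \<gamma> (i + k)" using L_cm x y by blast
  have zx: "cm z x \<in> \<gamma> (i + 1)" using cm_\<gamma>'[OF x z] by simp
  have yz: "cm y z \<in> \<gamma> (k + 1)" using cm_\<gamma>[OF y z] by simp
  have "cm (cm x y) (inv x \<otimes> z \<otimes> x) \<in> \<gamma> (Suc (Suc (i + k)))"
    using 1 L_cm_le[OF xy zx] assms(4,5) by (subst cm_conj_iff) auto
  moreover have "cm (cm z x) (inv z \<otimes> y \<otimes> z) \<in> \<gamma> (Suc (Suc (i + k)))"
    using 2 L_cm_le[OF zx yz] assms(4,5) by (subst cm_conj_iff) auto
  moreover have "inv (cm (cm y z) (inv y \<otimes> x \<otimes> y))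
      = cm (cm x y) (inv x \<otimes> z \<otimes> x) \<otimes> cm (cm z x) (inv z \<otimes> y \<otimes> z)"
    using hall_witt[of x y z] by (intro inv_equality) auto
  ultimately have "inv (cm (cm y z) (inv y \<otimes> x \<otimes> y)) \<in> \<gamma> (Suc (Suc (i + k)))" using L_mult by simp
  from L_inv[OF this] have "cm (cm y z) (inv y \<otimes> x \<otimes> y) \<in> \<gamma> (Suc (Suc (i + k)))" by simp
  then show ?thesis
    using L_cm_le[OF yz xy] assms(4,5) by (subst (asm) cm_conj_iff) auto
qed

end

lemma (in group) pow_card_ratio_mem:
  assumes K: "K \<lhd> G" and H: "subgroup H G" and KH: "K \<subseteq> H" and fin: "finite H"
    and card: "card H = q * card K" and x: "x \<in> H"
  shows "x [^] q \<in> K"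
proof -
  let ?H = "G\<lparr>carrier := H\<rparr>"
  interpret H: group ?H by (rule subgroup_imp_group[OF H])
  interpret K: normal K ?H by (rule normal_restrict_supergroup[OF H K KH])
  interpret Q: group "?H Mod K" by (rule K.factorgroup_is_group)
  have "card K > 0" using fin KH K.one_closed by (metis card_gt_0_iff emptyE finite_subset)
  moreover have "card (rcosets\<^bsub>?H\<^esub> K) * card K = card H"
    using H.lagrange[OF K.is_subgroup] by (simp add: order_def)
  ultimately have "card (rcosets\<^bsub>?H\<^esub> K) = q" using card by simp
  then have "order (?H Mod K) = q" by (simp add: order_def FactGroup_def)
  moreover have xin: "K #>\<^bsub>?H\<^esub> x \<in> carrier (?H Mod K)" using x by (auto simp: carrier_FactGroup)
  ultimately have "(K #>\<^bsub>?H\<^esub> x) [^]\<^bsub>?H Mod K\<^esub> q = K" using Q.pow_order_eq_1[OF xin] by simp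
  then have "K #>\<^bsub>?H\<^esub> (x [^]\<^bsub>?H\<^esub> q) = K" using K.FactGroup_pow[of x q] x by simp
  then have "x [^]\<^bsub>?H\<^esub> q \<in> K"
    using x by (intro H.coset_join1[OF _ H.nat_pow_closed K.is_subgroup]) auto
  then show ?thesis by (simp add: nat_pow_consistent[symmetric])
qed

section \<open>Groups of maximal class\<close>

locale maximal_class = central_series +
  fixes p n :: nat
  assumes prime_p: "prime p" and p_gt_2: "p > 2" and n_gt_2: "n > 2"
    and maximal_class: "maximal_class_group p n G"
begin

lemma order_G: "card (carrier G) = p ^ n"
  using maximal_class by (simp add: maximal_class_group_def order_def)

lemma finite_G [simp]: "finite (carrier G)"
  using order_G p_gt_2 card_gt_0_iff by fastforce

text \<open>\<open>nilpotency_class\<close> counts \<open>lower_central\<close> from 0 and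
  \<open>\<gamma>\<close> is shifted by one, so class \<open>n - 1\<close> makes
  \<open>\<gamma> n\<close> the first trivial term.\<close>

lemma \<gamma>_eq_one_iff: "1 \<le> i \<Longrightarrow> i \<le> n \<Longrightarrow> \<gamma> i = {\<one>} \<longleftrightarrow> i = n"
proof -
  have "\<exists>c. lower_central G c = {\<one>}" and c: "(LEAST c. lower_central G c = {\<one>}) = n - 1"
    using maximal_class by (auto simp: maximal_class_group_def nilpotent_def nilpotency_class_def)
  then have "lower_central G (n - 1) = {\<one>}" by (metis (mono_tags, lifting) LeastI_ex)
  moreover have "lower_central G c \<noteq> {\<one>}" if "c < n - 1" for c
    using not_less_Least[of c "\<lambda>c. lower_central G c = {\<one>}"] that unfolding c by blast
  ultimately show "1 \<le> i \<Longrightarrow> i \<le> n \<Longrightarrow> ?thesis"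
    unfolding \<gamma>_def by (metis diff_less_mono le_neq_implies_less)
qed

lemma \<gamma>_n [simp]: "\<gamma> n = {\<one>}"
  using \<gamma>_eq_one_iff[of n] n_gt_2 by simp

lemma \<gamma>_strict: 
  assumes "1 \<le> i" "i < n"
  shows "\<gamma> (Suc i) \<subset> \<gamma> i"
proof (rule ccontr)
  assume "\<not> \<gamma> (Suc i) \<subset> \<gamma> i"
  then have "\<gamma> (Suc i) = \<gamma> i" using L_Suc by blast
  then have eq: "lower_central G (Suc (i - 1)) = lower_central G (i - 1)"
    using assms by (simp add: \<gamma>_def)
  have "lower_central G (i - 1 + k) = lower_central G (i - 1)" for k
  proof (induction k)
    case (Suc k)
    have "lower_central G (i - 1 + Suc k) = lower_central G (Suc (i - 1))"
      using Suc by (simp add: lower_central.simps(2))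
    then show ?case using eq by simp
  qed simp
  from this[of "n - i"] have "\<gamma> n = \<gamma> i" using assms by (simp add: \<gamma>_def)
  then show False using \<gamma>_eq_one_iff[of i] assms by simp
qed

lemma card_subgroup:
  assumes "subgroup H G"
  obtains a where "a \<le> n" "card H = p ^ a"
proof -
  have "card H dvd p ^ n" using lagrange[OF assms] order_G by (metis dvd_triv_right order_def)
  then show ?thesis using that divides_primepow_nat[OF prime_p] by blast
qed

lemma subgroup_finite: "subgroup H G \<Longrightarrow> finite H"
  using finite_G rev_finite_subset subgroup.subset by blast

lemma card_subgroup_less:
  assumes "subgroup H G" "K \<subset> H" "card K = p ^ a" "card H = p ^ b"
  shows "a < b"
proof -
  have "card K < card H" using psubset_card_mono[OF subgroup_finite[OF assms(1)] assms(2)] .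
  then have "p ^ a < p ^ b" using assms(3,4) by simp
  then show ?thesis using p_gt_2 by (simp add: power_strict_increasing_iff)
qed

lemma subgroup_eq_if_card:
  assumes "subgroup H G" "K \<subseteq> H" "card H \<le> card K"
  shows "K = H"
  using card_seteq[OF subgroup_finite[OF assms(1)] assms(2,3)] .

text \<open>The quotient by \<open>\<gamma> 2\<close> is not cyclic. Otherwise the centralizer of
  \<open>g\<close> modulo \<open>\<gamma> 3\<close> contains \<open>g\<close> and
  \<open>\<gamma> 2\<close>, hence is everything; then the centralizer of all elements is everything
  too, and the group is abelian modulo \<open>\<gamma> 3\<close>.\<close>

lemma exists_proper_subgroup:
  assumes g: "g \<in> carrier G"
  shows "\<exists>H. subgroup H G \<and> \<gamma> 2 \<subseteq> H \<and> g \<in> H \<and> H \<noteq> carrier G"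
proof (rule ccontr)
  assume "\<not> ?thesis"
  then have all: "H = carrier G" if "subgroup H G" "\<gamma> 2 \<subseteq> H" "g \<in> H" for H using that by blast
  have 2: "\<gamma> 2 \<subseteq> cmod 3 T" if "T \<subseteq> carrier G" for T
    using that cm_\<gamma>[of _ 2] by (auto simp: cmod_def numeral_3_eq_3 numeral_2_eq_2)
  have "cmod 3 {g} = carrier G"
    using g by (intro all subgroup_cmod 2) (auto simp: cmod_def cm_eq_one_iff[THEN iffD2])
  then have "cmod 3 (carrier G) = carrier G"
    using g by (intro all subgroup_cmod 2) (auto simp: cmod_def intro: cm_\<gamma>_swap)
  then have "\<gamma> (Suc 1) \<subseteq> \<gamma> 3" by (intro \<gamma>_Suc_minimal subgroup_L) (auto simp: cmod_def)
  then show False using \<gamma>_strict[of 2] n_gt_2 by (auto simp: numeral_3_eq_3 numeral_2_eq_2)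
qed

text \<open>The exponents of \<open>p\<close> decrease strictly. Counting from the trivial term
  gives the lower bound. Counting from the top gives the upper bound, where the first step loses two
  factors because a subgroup fits strictly between \<open>\<gamma> 2\<close> and the whole
  group.\<close>

lemma card_\<gamma>:
  assumes "2 \<le> i" "i \<le> n"
  shows "card (\<gamma> i) = p ^ (n - i)"
proof -
  have "\<exists>a. card (\<gamma> j) = p ^ a" for j by (rule card_subgroup[OF subgroup_L]) blast
  then obtain a where a: "card (\<gamma> j) = p ^ a j" for j using choice[of "\<lambda>j a. card (\<gamma> j) = p ^ a"] by blast
  have dec: "a (Suc j) < a j" if "1 \<le> j" "j < n" for j
    using card_subgroup_less[OF subgroup_L \<gamma>_strict[OF that] a a] .
  have le: "a i \<le> n - i" if "2 \<le> i" "i \<le> n" for i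
    using that
  proof (induction i rule: dec_induct)
    case base
    obtain g where g: "g \<in> carrier G" "g \<notin> \<gamma> 2" using \<gamma>_strict[of 1] n_gt_2 by (auto simp: numeral_2_eq_2)
    obtain H where H: "subgroup H G" "\<gamma> 2 \<subseteq> H" "g \<in> H" "H \<noteq> carrier G"
      using exists_proper_subgroup[OF g(1)] by blast
    obtain b where b: "card H = p ^ b" using card_subgroup[OF H(1)] by blast
    have "a 2 < b" using H g by (intro card_subgroup_less[OF H(1) _ a b]) auto
    moreover have "b < n" using H subgroup.subset[OF H(1)]
      by (intro card_subgroup_less[OF subgroup_self _ b order_G]) auto
    ultimately show ?case by simp
  next
    case (step i)
    then show ?case using dec[of i] by simp
  qed
  have ge: "a i \<ge> n - i" if "1 \<le> i" "i \<le> n" for i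
    using that(2,1)
  proof (induction i rule: inc_induct)
    case (step i)
    then show ?case using dec[of i] by simp
  qed simp
  show ?thesis using le[OF assms] ge[of i] assms a[of i] by simp
qed

text \<open>Consecutive terms have index \<open>p\<close>, so no subgroup lies strictly between
  them.\<close>

lemma \<gamma>_generated:
  assumes i: "2 \<le> i" "i < n" and c: "c \<in> \<gamma> i" "c \<notin> \<gamma> (Suc i)"
    and S: "subgroup S G" "\<gamma> (Suc i) \<subseteq> S" "c \<in> S"
  shows "\<gamma> i \<subseteq> S"
proof -
  have SI: "subgroup (S \<inter> \<gamma> i) G" by (rule subgroups_Inter_pair[OF S(1) subgroup_L])
  obtain b where b: "card (S \<inter> \<gamma> i) = p ^ b" using card_subgroup[OF SI] by blast
  have "n - Suc i < b"
    using c S L_Suc[of i] i by (intro card_subgroup_less[OF SI _ card_\<gamma> b]) auto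
  then have "card (\<gamma> i) \<le> card (S \<inter> \<gamma> i)" using i p_gt_2 by (simp add: b card_\<gamma>)
  then have "S \<inter> \<gamma> i = \<gamma> i" by (intro subgroup_eq_if_card[OF subgroup_L]) auto
  then show ?thesis by blast
qed

lemma pow_p_\<gamma>:
  assumes i: "1 \<le> i" "i < n" and x: "x \<in> \<gamma> i"
  shows "x [^] p \<in> \<gamma> (Suc i)"
proof (cases "i = 1")
  case False
  then have "card (\<gamma> i) = p * card (\<gamma> (Suc i))"
    using i by (simp add: card_\<gamma> Suc_diff_Suc flip: power_Suc)
  then show ?thesis
    by (intro pow_card_ratio_mem[OF normal_\<gamma> subgroup_L L_Suc _ _ x]) (auto intro: subgroup_finite subgroup_L)
next
  case True
  show ?thesis
  proof (cases "x \<in> \<gamma> 2")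
    case True2: True
    then show ?thesis using True L_pow[OF True2] by (simp add: numeral_2_eq_2)
  next
    case False
    \<comment> \<open>The top factor has order \<open>p ^ 2\<close>, so the power is computed in a
      subgroup \<open>H\<close> that contains \<open>x\<close> and in which
      \<open>\<gamma> 2\<close> has index \<open>p\<close>.\<close>
    obtain H where H: "subgroup H G" "\<gamma> 2 \<subseteq> H" "x \<in> H" "H \<noteq> carrier G"
      using exists_proper_subgroup[of x] x by blast
    obtain b where b: "card H = p ^ b" using card_subgroup[OF H(1)] by blast
    have "n - 2 < b" using H False n_gt_2 by (intro card_subgroup_less[OF H(1) _ card_\<gamma> b]) auto
    moreover have "b < n" using H subgroup.subset[OF H(1)]
      by (intro card_subgroup_less[OF subgroup_self _ b order_G]) auto
    ultimately have "b = Suc (n - 2)" by simp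
    then have "card H = p * card (\<gamma> 2)" using b n_gt_2 by (simp add: card_\<gamma>)
    then have "x [^] p \<in> \<gamma> 2"
      using H by (intro pow_card_ratio_mem[OF normal_\<gamma> H(1)]) (auto intro: subgroup_finite)
    then show ?thesis using True by (simp add: numeral_2_eq_2)
  qed
qed

text \<open>Take \<open>y\<close> outside a proper subgroup \<open>K\<close> containing
  \<open>g\<close> and \<open>\<gamma> 2\<close>. Then \<open>\<gamma> 2\<close>,
  \<open>H \<inter> K\<close> and \<open>H\<close> form a strictly increasing chain, and
  \<open>\<gamma> 2\<close> has index only \<open>p ^ 2\<close>.\<close>

lemma exists_cogenerator:
  assumes g: "g \<in> carrier G" "g \<notin> \<gamma> 2"
  obtains y where "y \<in> carrier G"
    "\<And>H. \<lbrakk>subgroup H G; \<gamma> 2 \<subseteq> H; g \<in> H; y \<in> H\<rbrakk> \<Longrightarrow> H = carrier G"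
proof -
  obtain K where K: "subgroup K G" "\<gamma> 2 \<subseteq> K" "g \<in> K" "K \<noteq> carrier G"
    using exists_proper_subgroup[OF g(1)] by blast
  obtain b where b: "card K = p ^ b" using card_subgroup[OF K(1)] by blast
  have bn: "b < n" using K subgroup.subset[OF K(1)]
    by (intro card_subgroup_less[OF subgroup_self _ b order_G]) auto
  obtain y where y: "y \<in> carrier G" "y \<notin> K" using K subgroup.subset[OF K(1)] by blast
  have "H = carrier G" if H: "subgroup H G" "\<gamma> 2 \<subseteq> H" "g \<in> H" "y \<in> H" for H
  proof -
    have HK: "subgroup (H \<inter> K) G" by (rule subgroups_Inter_pair[OF H(1) K(1)])
    obtain c where c: "card (H \<inter> K) = p ^ c" using card_subgroup[OF HK] by blast
    obtain d where d: "d \<le> n" "card H = p ^ d" using card_subgroup[OF H(1)] by blast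
    have "n - 2 < c" using H K g n_gt_2 by (intro card_subgroup_less[OF HK _ card_\<gamma> c]) auto
    moreover have "c < d" using H y by (intro card_subgroup_less[OF H(1) _ c d(2)]) auto
    ultimately have "d = n" using d n_gt_2 by simp
    then show ?thesis using d order_G subgroup.subset[OF H(1)]
      by (intro subgroup_eq_if_card[OF subgroup_self]) auto
  qed
  then show ?thesis using that y by blast
qed

section \<open>Two-step centralizers of the sections
  \<open>\<gamma> j / \<gamma> (j + 2)\<close>\<close>

definition centralizer2 :: "nat \<Rightarrow> 'a set" where
  "centralizer2 j = cmod (Suc (Suc j)) (\<gamma> j)"

lemma subgroup_centralizer2: "subgroup (centralizer2 j) G"
  unfolding centralizer2_def by (rule subgroup_cmod) auto

lemma \<gamma>_2_centralizer2: "\<gamma> 2 \<subseteq> centralizer2 j"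
  unfolding centralizer2_def cmod_def by (auto intro: L_cm_le)

lemma not_all_cm:
  assumes "1 \<le> j" "Suc j < n" and "\<And>x y. x \<in> \<gamma> j \<Longrightarrow> y \<in> carrier G \<Longrightarrow> cm x y \<in> \<gamma> (Suc (Suc j))"
  shows False
proof -
  have "\<gamma> (Suc j) \<subseteq> \<gamma> (Suc (Suc j))" using assms by (intro \<gamma>_Suc_minimal subgroup_L)
  then show False using \<gamma>_strict[of "Suc j"] assms by auto
qed

lemma centralizer2_proper:
  assumes "1 \<le> j" "Suc j < n"
  shows "centralizer2 j \<noteq> carrier G"
proof
  assume *: "centralizer2 j = carrier G"
  show False
    by (rule not_all_cm[OF assms]) (use * in \<open>auto simp: centralizer2_def cmod_def intro: cm_\<gamma>_swap\<close>)
qed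

end

section \<open>Iterated commutators and the binomial expansion of conjugation\<close>

context group
begin

primrec iterated_cm :: "'a \<Rightarrow> 'a \<Rightarrow> nat \<Rightarrow> 'a" where
  "iterated_cm a g 0 = a"
| "iterated_cm a g (Suc i) = cm (iterated_cm a g i) g"

lemma iterated_cm_closed [simp, intro]:
  "a \<in> carrier G \<Longrightarrow> g \<in> carrier G \<Longrightarrow> iterated_cm a g i \<in> carrier G"
  by (induction i) auto

lemma iterated_cm_add: "iterated_cm (iterated_cm a g i) g k = iterated_cm a g (i + k)"
  by (induction k) auto

text \<open>On commuting iterated commutators, conjugation by \<open>g\<close> acts as
  \<open>1 + D\<close>, where \<open>D\<close> is the commutator map with \<open>g\<close>. The
  claim is the binomial theorem for powers of \<open>1 + D\<close>.\<close>

lemma conj_pow_taylor: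
  assumes cl: "a \<in> carrier G" "g \<in> carrier G"
    and comm: "\<And>i k. iterated_cm a g i \<otimes> iterated_cm a g k = iterated_cm a g k \<otimes> iterated_cm a g i"
    and "m \<le> k"
  shows "inv (g [^] m) \<otimes> a \<otimes> g [^] m = taylor (iterated_cm a g) m k"
proof -
  define d where "d = iterated_cm a g"
  have dcl [simp]: "d i \<in> carrier G" for i using cl by (simp add: d_def)
  have tcl [simp]: "taylor d m k \<in> carrier G" for m k by (rule taylor_carrier) simp
  have step: "inv g \<otimes> d i \<otimes> g = d i \<otimes> d (Suc i)" for i using cl by (simp add: d_def conj_eq_cm)
  \<comment> \<open>Truncating at \<open>k\<close> leaves one surplus factor, whose exponent
    \<open>m choose k\<close> is 0 as long as \<open>m < k\<close>.\<close>
  have conj: "inv g \<otimes> taylor d m k \<otimes> g = taylor d (Suc m) k \<otimes> d (Suc k) [^] (m choose k)" for m k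
  proof (induction k)
    case 0
    show ?case by (simp add: step)
  next
    case (Suc k)
    let ?c = "m choose Suc k"
    have "inv g \<otimes> taylor d m (Suc k) \<otimes> g
        = (inv g \<otimes> taylor d m k \<otimes> g) \<otimes> (inv g \<otimes> d (Suc k) [^] ?c \<otimes> g)"
      using cl by (simp add: m_assoc)
    also have "inv g \<otimes> d (Suc k) [^] ?c \<otimes> g = (d (Suc k) \<otimes> d (Suc (Suc k))) [^] ?c"
      using cl by (simp add: step flip: conj_pow)
    also have "\<dots> = d (Suc k) [^] ?c \<otimes> d (Suc (Suc k)) [^] ?c"
      using comm[of "Suc k" "Suc (Suc k)"] by (intro pow_mult_distrib) (auto simp: d_def[symmetric] simp del: iterated_cm.simps)
    finally show ?case by (simp add: Suc m_assoc flip: nat_pow_mult)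
  qed
  have "m \<le> k \<Longrightarrow> inv (g [^] m) \<otimes> a \<otimes> g [^] m = taylor d m k" for m
  proof (induction m)
    case 0
    have "taylor d 0 k = a" by (induction k) (use cl in \<open>simp_all add: d_def\<close>)
    then show ?case using cl by simp
  next
    case (Suc m)
    have "inv (g [^] Suc m) \<otimes> a \<otimes> g [^] Suc m = inv g \<otimes> (inv (g [^] m) \<otimes> a \<otimes> g [^] m) \<otimes> g"
      using cl by (simp add: word_simps)
    also have "\<dots> = taylor d (Suc m) k" using Suc conj[of m k] by (simp add: binomial_eq_0)
    finally show ?case .
  qed
  with \<open>m \<le> k\<close> show ?thesis by (simp add: d_def)
qed

end

lemma (in group_hom) hom_cm: "x \<in> carrier G \<Longrightarrow> y \<in> carrier G \<Longrightarrow> h (G.cm x y) = H.cm (h x) (h y)"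
  by (simp add: G.cm_def H.cm_def)

lemma (in group_hom) hom_iterated_cm:
  "a \<in> carrier G \<Longrightarrow> g \<in> carrier G \<Longrightarrow> h (G.iterated_cm a g i) = H.iterated_cm (h a) (h g) i"
  by (induction i) (simp_all add: hom_cm)

lemma (in group_hom) hom_taylor:
  "(\<And>i. i \<le> k \<Longrightarrow> a i \<in> carrier G) \<Longrightarrow> h (G.taylor a m k) = H.taylor (\<lambda>i. h (a i)) m k"
  by (induction k) (simp_all add: G.taylor_carrier hom_nat_pow)

lemma (in normal) group_hom_Mod: "group_hom G (G Mod H) (\<lambda>x. H #> x)"
  using r_coset_hom_Mod factorgroup_is_group by (simp add: group_hom_def group_hom_axioms_def is_group)

lemma (in normal) rcos_one_if_mem: "x \<in> H \<Longrightarrow> H #> x = \<one>\<^bsub>G Mod H\<^esub>"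
  using coset_join2[of x H] is_subgroup mem_carrier by simp

lemma (in normal) mem_if_rcos_one: "H #> x = \<one>\<^bsub>G Mod H\<^esub> \<Longrightarrow> x \<in> carrier G \<Longrightarrow> x \<in> H"
  using coset_join1[of H x] is_subgroup by simp

lemma (in normal) cm_mem_commute:
  assumes cl: "x \<in> carrier G" "y \<in> carrier G" and "cm x y \<in> H"
  shows "(H #> x) \<otimes>\<^bsub>G Mod H\<^esub> (H #> y) = (H #> y) \<otimes>\<^bsub>G Mod H\<^esub> (H #> x)"
proof -
  interpret \<pi>: group_hom G "G Mod H" "\<lambda>x. H #> x" by (rule group_hom_Mod)
  have "H #> cm x y = \<one>\<^bsub>G Mod H\<^esub>" using assms(3) by (rule rcos_one_if_mem)
  then show ?thesis using cl by (simp add: \<pi>.hom_cm \<pi>.H.cm_eq_one_iff del: mult_FactGroup one_FactGroup)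
qed

lemma (in normal) pow_mult_mem:
  assumes cl: "x \<in> carrier G" "y \<in> carrier G" and "cm x y \<in> H" and "y [^] (q::nat) \<in> H"
  shows "inv (x [^] q) \<otimes> (x \<otimes> y) [^] q \<in> H"
proof -
  interpret \<pi>: group_hom G "G Mod H" "\<lambda>x. H #> x" by (rule group_hom_Mod)
  have "H #> (y [^] q) = \<one>\<^bsub>G Mod H\<^esub>" using assms(4) by (rule rcos_one_if_mem)
  then have "H #> ((x \<otimes> y) [^] q) = H #> (x [^] q)"
    using cl cm_mem_commute[OF assms(1-3)]
    by (simp add: \<pi>.hom_nat_pow \<pi>.H.pow_mult_distrib del: mult_FactGroup one_FactGroup)
  then have "H #> (inv (x [^] q) \<otimes> (x \<otimes> y) [^] q) = \<one>\<^bsub>G Mod H\<^esub>"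
    using cl by (simp add: \<pi>.H.l_inv del: mult_FactGroup one_FactGroup)
  then show ?thesis using cl by (intro mem_if_rcos_one) auto
qed

context maximal_class
begin

lemma \<gamma>_generated_cm:
  assumes "2 \<le> i" "i < n" "c \<in> \<gamma> i" "c \<notin> \<gamma> (Suc i)" "x \<in> carrier G" "cm c x \<in> \<gamma> (Suc (Suc i))" "a \<in> \<gamma> i"
  shows "cm a x \<in> \<gamma> (Suc (Suc i))"
proof -
  have "\<gamma> i \<subseteq> cmod (Suc (Suc i)) {x}"
    using assms by (intro \<gamma>_generated[of i c] subgroup_cmod) (auto simp: cmod_def dest: cm_\<gamma>)
  then show ?thesis using assms(7) by (auto simp: cmod_def)
qed

lemma not_all_cm_generator:
  assumes "2 \<le> j" "Suc j < n" "c \<in> \<gamma> j" "c \<notin> \<gamma> (Suc j)" "\<And>x. x \<in> carrier G \<Longrightarrow> cm c x \<in> \<gamma> (Suc (Suc j))"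
  shows False
  using assms by (intro not_all_cm[of j]) (auto intro: \<gamma>_generated_cm[of j c])

lemma cm_notin_if_not_centralizer2:
  assumes "2 \<le> i" "i < n" "c \<in> \<gamma> i" "c \<notin> \<gamma> (Suc i)" "g \<in> carrier G" "g \<notin> centralizer2 i"
  shows "cm c g \<notin> \<gamma> (Suc (Suc i))"
proof
  assume "cm c g \<in> \<gamma> (Suc (Suc i))"
  then have "cm g a \<in> \<gamma> (Suc (Suc i))" if "a \<in> \<gamma> i" for a
    using assms that \<gamma>_generated_cm[of i c g a] by (intro cm_\<gamma>_swap[of a g]) auto
  then have "g \<in> centralizer2 i" using assms by (simp add: centralizer2_def cmod_def)
  with assms show False by simp
qed

text \<open>If \<open>g [^] p\<close> lay in \<open>\<gamma> k\<close> but not in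
  \<open>\<gamma> (Suc k)\<close>, it would generate that section of order \<open>p\<close>.
  Commuting with \<open>g\<close>, it would force \<open>g\<close> into
  \<open>centralizer2 k\<close>.\<close>

lemma pow_p_mem_\<gamma>:
  assumes "g \<in> carrier G" "2 \<le> k" "k < n" "\<And>i. 2 \<le> i \<Longrightarrow> i < k \<Longrightarrow> g \<notin> centralizer2 i"
  shows "g [^] p \<in> \<gamma> k"
  using assms(2-4)
proof (induction k rule: dec_induct)
  case base
  show ?case using pow_p_\<gamma>[of 1 g] assms(1) n_gt_2 by (simp add: numeral_2_eq_2)
next
  case (step k)
  show ?case
  proof (rule ccontr)
    assume "g [^] p \<notin> \<gamma> (Suc k)"
    then have "cm (g [^] p) g \<notin> \<gamma> (Suc (Suc k))"
      using step assms(1) by (intro cm_notin_if_not_centralizer2) auto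
    moreover have "cm (g [^] p) g = \<one>"
      using assms(1) by (simp add: cm_eq_one_iff nat_pow_comm[of g p 1, simplified])
    ultimately show False by simp
  qed
qed

text \<open>Otherwise the centralizers of \<open>g\<close> and \<open>y\<close> modulo
  \<open>\<gamma> 3\<close> both contain \<open>g\<close>, \<open>y\<close> and
  \<open>\<gamma> 2\<close>, and the group is abelian modulo \<open>\<gamma> 3\<close>.\<close>

lemma cm_cogenerator_notin:
  assumes g: "g \<in> carrier G" "y \<in> carrier G"
    and all: "\<And>H. \<lbrakk>subgroup H G; \<gamma> 2 \<subseteq> H; g \<in> H; y \<in> H\<rbrakk> \<Longrightarrow> H = carrier G"
  shows "cm y g \<notin> \<gamma> 3"
proof
  assume 1: "cm y g \<in> \<gamma> 3"
  have 2: "\<gamma> 2 \<subseteq> cmod 3 T" if "T \<subseteq> carrier G" for T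
    using that cm_\<gamma>[of _ 2] by (auto simp: cmod_def numeral_3_eq_3 numeral_2_eq_2)
  have "cm g g = \<one>" "cm y y = \<one>" using g by (simp_all add: cm_eq_one_iff)
  then have "cmod 3 {g} = carrier G" "cmod 3 {y} = carrier G"
    using g 1 cm_\<gamma>_swap[OF g(2,1) 1] by (intro all subgroup_cmod 2; auto simp: cmod_def)+
  then have "cmod 3 (carrier G) = carrier G"
    using g by (intro all subgroup_cmod 2) (auto simp: cmod_def intro: cm_\<gamma>_swap)
  then show False using not_all_cm[of 1] n_gt_2 by (auto simp: cmod_def numeral_3_eq_3)
qed

end

section \<open>The first section centralized by an element: parity and bound of its index\<close>

text \<open>\<open>j\<close> is the first index at which \<open>g\<close> centralizes \<open>\<gamma> j / \<gamma> (j + 2)\<close>.\<close>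

locale first_centralizer = maximal_class +
  fixes g :: 'a and j :: nat
  assumes g [simp]: "g \<in> carrier G" and g_notin: "g \<notin> \<gamma> 2"
    and j: "2 \<le> j" "Suc j < n" and centralizes: "g \<in> centralizer2 j"
    and first: "\<And>i. 2 \<le> i \<Longrightarrow> i < j \<Longrightarrow> g \<notin> centralizer2 i"
begin

lemma cm_g: "a \<in> \<gamma> j \<Longrightarrow> cm a g \<in> \<gamma> (Suc (Suc j))"
  using centralizes by (auto simp: centralizer2_def cmod_def intro: cm_\<gamma>_swap)

definition y :: 'a where
  "y = (SOME y. y \<in> carrier G \<and> (\<forall>H. subgroup H G \<longrightarrow> \<gamma> 2 \<subseteq> H \<longrightarrow> g \<in> H \<longrightarrow> y \<in> H \<longrightarrow> H = carrier G))"

lemma y [simp]: "y \<in> carrier G"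
  and cogenerator: "\<lbrakk>subgroup H G; \<gamma> 2 \<subseteq> H; g \<in> H; y \<in> H\<rbrakk> \<Longrightarrow> H = carrier G"
proof -
  have "\<exists>y. y \<in> carrier G \<and> (\<forall>H. subgroup H G \<longrightarrow> \<gamma> 2 \<subseteq> H \<longrightarrow> g \<in> H \<longrightarrow> y \<in> H \<longrightarrow> H = carrier G)"
    by (rule exists_cogenerator[OF g g_notin]) blast
  from someI_ex[OF this] show "y \<in> carrier G"
    "\<lbrakk>subgroup H G; \<gamma> 2 \<subseteq> H; g \<in> H; y \<in> H\<rbrakk> \<Longrightarrow> H = carrier G"
    unfolding y_def by blast+
qed

abbreviation e :: "nat \<Rightarrow> 'a" where
  "e \<equiv> iterated_cm y g"

lemma iterated_cm_mem: "a \<in> \<gamma> i \<Longrightarrow> iterated_cm a g k \<in> \<gamma> (i + k)"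
  by (induction k) (simp_all add: cm_\<gamma>)

lemma e_mem: "e i \<in> \<gamma> (Suc i)"
  using iterated_cm_mem[of y 1 i] by simp

text \<open>Commutation with \<open>g\<close> carries a generator of a section to a generator of the
  next one while \<open>g\<close> does not centralize it. The first two members rest on
  \<open>cm y g \<notin> \<gamma> 3\<close>.\<close>

lemma e_notin: "Suc i \<le> j \<Longrightarrow> e i \<notin> \<gamma> (Suc (Suc i))"
proof (induction i)
  case 0
  have "cm y g \<notin> \<gamma> 3" by (rule cm_cogenerator_notin[OF g y cogenerator])
  then show ?case using cm_\<gamma>[of y 2 g] by (auto simp: numeral_3_eq_3 numeral_2_eq_2)
next
  case (Suc i)
  show ?case
  proof (cases i)
    case 0
    have "cm y g \<notin> \<gamma> 3" by (rule cm_cogenerator_notin[OF g y cogenerator])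
    with 0 show ?thesis by (simp add: numeral_3_eq_3)
  next
    case (Suc k)
    then show ?thesis
      using cm_notin_if_not_centralizer2[of "Suc i" "e i" g] Suc.IH Suc.prems e_mem[of i] j first[of "Suc i"] by auto
  qed
qed

text \<open>
  By the Hall--Witt identity all \<open>[e a, e b]\<close> with \<open>a + b = j - 1\<close> agree up to sign modulo
  \<open>\<gamma> (j + 2)\<close>. For odd \<open>j\<close> one of them is \<open>[e a, e a] = 1\<close>, hence \<open>y\<close> would centralize
  \<open>\<gamma> j / \<gamma> (j + 2)\<close> as well.
\<close>

theorem even_j: "even j"
proof (rule ccontr)
  assume "odd j"
  then obtain q where q: "j = Suc (2 * q)" by (metis oddE Suc_eq_plus1)
  \<comment> \<open>Hall--Witt for \<open>e a\<close>, \<open>e b\<close> and \<open>g\<close> moves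
    one commutation with \<open>g\<close> from the first entry to the second. The remaining term
    dies because \<open>[e a, e b]\<close> lies in \<open>\<gamma> j\<close>, where commuting with
    \<open>g\<close> gains two levels.\<close>
  have step: "cm (e a) (e (Suc b)) \<in> \<gamma> (Suc (Suc j))" if ab: "Suc (Suc (a + b)) = j" and c: "cm (e (Suc a)) (e b) \<in> \<gamma> (Suc (Suc j))" for a b
  proof -
    have S: "subgroup (cmod (Suc (Suc j)) {e b}) G" by (rule subgroup_cmod) simp
    have "e (Suc a) \<in> cmod (Suc (Suc j)) {e b}" using c by (simp add: cmod_def)
    from subgroup.m_inv_closed[OF S this] have "cm (cm g (e a)) (e b) \<in> \<gamma> (Suc (Suc j))"
      by (simp add: inv_cm cmod_def)
    moreover have "cm (cm (e a) (e b)) g \<in> \<gamma> (Suc (Suc j))"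
      using L_cm[OF e_mem[of a] e_mem[of b]] ab by (intro cm_g) simp
    ultimately have "cm (e (Suc b)) (e a) \<in> \<gamma> (Suc (Suc j))"
      using hall_witt_mod[OF e_mem[of a] e_mem[of b] g] by (simp flip: ab)
    then show ?thesis by (rule cm_\<gamma>_swap[rotated 2]) auto
  qed
  have "t \<le> q \<Longrightarrow> cm (e (q - t)) (e (q + t)) \<in> \<gamma> (Suc (Suc j))" for t
  proof (induction t)
    case 0
    then show ?case by (simp add: cm_eq_one_iff[THEN iffD2])
  next
    case (Suc t)
    then have "cm (e (Suc (q - Suc t))) (e (q + t)) \<in> \<gamma> (Suc (Suc j))" by (simp add: Suc_diff_Suc)
    from step[OF _ this] Suc.prems q show ?case by simp
  qed
  \<comment> \<open>The chain runs from \<open>[e q, e q]\<close> to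
    \<open>[e 0, e (2 * q)]\<close>, and \<open>e 0\<close> is \<open>y\<close>.\<close>
  from this[of q] have c: "cm y (e (j - 1)) \<in> \<gamma> (Suc (Suc j))" by (simp add: q mult_2)
  have e: "e (j - 1) \<in> \<gamma> j" "e (j - 1) \<notin> \<gamma> (Suc j)"
    using e_mem[of "j - 1"] e_notin[of "j - 1"] j by auto
  have "cmod (Suc (Suc j)) {e (j - 1)} = carrier G"
  proof (rule cogenerator)
    show "\<gamma> 2 \<subseteq> cmod (Suc (Suc j)) {e (j - 1)}" using e L_cm_le[of _ 2 _ j] by (auto simp: cmod_def)
    show "g \<in> cmod (Suc (Suc j)) {e (j - 1)}" using cm_g[OF e(1)] by (auto simp: cmod_def intro: cm_\<gamma>_swap)
    show "y \<in> cmod (Suc (Suc j)) {e (j - 1)}" using c by (simp add: cmod_def)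
  qed (auto intro: subgroup_cmod)
  then have "cm (e (j - 1)) x \<in> \<gamma> (Suc (Suc j))" if "x \<in> carrier G" for x
    using that by (intro cm_\<gamma>_swap[of x]) (auto simp: cmod_def)
  then show False using not_all_cm_generator[OF j e] by blast
qed

text \<open>
  If \<open>j\<close> is large then \<open>\<gamma> (j - p)\<close> is abelian modulo \<open>\<gamma> (j + 2)\<close> and centralized by \<open>g\<^sup>p\<close>.
  Expanding the action of \<open>g\<^sup>p\<close> binomially shows that \<open>\<gamma> (j - p + 2)\<close> has exponent \<open>p\<close> modulo
  \<open>\<gamma> (j + 2)\<close> while the \<open>p\<close>-th power of a generator of \<open>\<gamma> (j - p + 1)\<close> generates \<open>\<gamma> j\<close>.
  Hence all of \<open>G\<close> centralizes \<open>\<gamma> j / \<gamma> (j + 2)\<close>, which is impossible.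
\<close>

context
  assumes large: "2 * p + 2 \<le> j"
begin

text \<open>As \<open>g [^] p\<close> lies in \<open>\<gamma> j\<close>, it acts trivially on
  \<open>a\<close> modulo \<open>\<gamma> (j + 2)\<close>, so the binomial expansion of this action
  reduces to its linear and top terms. The iterated commutators commute because
  \<open>2 * (j - p) \<ge> j + 2\<close>.\<close>

lemma expansion_mod:
  assumes a: "a \<in> \<gamma> i" and i: "j - p \<le> i"
    and pow: "\<And>k. 2 \<le> k \<Longrightarrow> k < p \<Longrightarrow> iterated_cm a g k [^] p \<in> \<gamma> (Suc (Suc j))"
  shows "cm a g [^] p \<otimes> iterated_cm a g p \<in> \<gamma> (Suc (Suc j))"
proof -
  interpret K: normal "\<gamma> (Suc (Suc j))" G by (rule normal_\<gamma>)
  let ?Q = "G Mod \<gamma> (Suc (Suc j))" and ?\<pi> = "\<lambda>x. \<gamma> (Suc (Suc j)) #> x"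
  interpret \<pi>: group_hom G ?Q ?\<pi> by (rule K.group_hom_Mod)
  let ?d = "iterated_cm a g"
  have acl [simp]: "a \<in> carrier G" using a by auto
  have gp: "g [^] p \<in> \<gamma> j" using j first by (intro pow_p_mem_\<gamma>) auto
  have comm: "?\<pi> (?d i) \<otimes>\<^bsub>?Q\<^esub> ?\<pi> (?d k) = ?\<pi> (?d k) \<otimes>\<^bsub>?Q\<^esub> ?\<pi> (?d i)" for i k
    using large \<open>j - p \<le> _\<close>
    by (intro K.cm_mem_commute L_cm_le[OF iterated_cm_mem[OF a] iterated_cm_mem[OF a]]) auto
  have "cm a (g [^] p) \<in> \<gamma> (Suc (Suc j))" using L_cm_le[OF a gp, of "Suc (Suc j)"] i large p_gt_2 by simp
  then have "?\<pi> (cm a (g [^] p)) = \<one>\<^bsub>?Q\<^esub>" by (rule K.rcos_one_if_mem)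
  then have "?\<pi> (inv (g [^] p) \<otimes> a \<otimes> g [^] p) = ?\<pi> a"
    using conj_eq_cm[of a "g [^] p"] by (simp add: \<pi>.hom_cm del: mult_FactGroup one_FactGroup)
  moreover have "inv\<^bsub>?Q\<^esub> (?\<pi> g [^]\<^bsub>?Q\<^esub> p) \<otimes>\<^bsub>?Q\<^esub> ?\<pi> a \<otimes>\<^bsub>?Q\<^esub> ?\<pi> g [^]\<^bsub>?Q\<^esub> p
      = \<pi>.H.taylor (\<pi>.H.iterated_cm (?\<pi> a) (?\<pi> g)) p p"
    using comm by (intro \<pi>.H.conj_pow_taylor) (auto simp: \<pi>.hom_iterated_cm simp del: mult_FactGroup one_FactGroup)
  then have "?\<pi> (inv (g [^] p) \<otimes> a \<otimes> g [^] p) = ?\<pi> (taylor ?d p p)"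
    by (simp add: \<pi>.hom_taylor \<pi>.hom_iterated_cm \<pi>.hom_nat_pow del: mult_FactGroup one_FactGroup)
  moreover obtain h where h: "h \<in> \<gamma> (Suc (Suc j))" "taylor ?d p p = ?d 0 \<otimes> ?d 1 [^] p \<otimes> h \<otimes> ?d p"
    by (rule taylor_prime[OF prime_p subgroup_L, of ?d, OF _ pow]) auto
  moreover have "?\<pi> h = \<one>\<^bsub>?Q\<^esub>" using h(1) by (rule K.rcos_one_if_mem)
  ultimately have "?\<pi> a = ?\<pi> a \<otimes>\<^bsub>?Q\<^esub> ?\<pi> (cm a g [^] p \<otimes> ?d p)"
    by (simp add: \<pi>.H.m_assoc del: mult_FactGroup one_FactGroup)
  then have "?\<pi> (cm a g [^] p \<otimes> ?d p) = \<one>\<^bsub>?Q\<^esub>"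
    by (intro \<pi>.H.r_cancel_one'[THEN iffD1, of "?\<pi> a"]) (auto simp del: mult_FactGroup one_FactGroup)
  then show ?thesis by (rule K.mem_if_rcos_one) auto
qed

lemma pow_p_mem_low:
  assumes "j - p + 2 \<le> i" "i \<le> Suc (Suc j)" "w \<in> \<gamma> i"
  shows "w [^] p \<in> \<gamma> (Suc (Suc j))"
  using assms(2,1,3)
proof (induction i arbitrary: w rule: inc_induct)
  case base
  then show ?case by (simp add: L_pow)
next
  case (step i)
  show ?case
  proof (cases "i = Suc j")
    case True
    then show ?thesis using pow_p_\<gamma>[of "Suc j" w] step.prems j by simp
  next
    case False
    then have ij: "i \<le> j" using step.hyps by simp
    have i2: "2 \<le> i" using step.prems by simp
    let ?K = "\<gamma> (Suc (Suc j))"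
    interpret K: normal ?K G by (rule normal_\<gamma>)
    define S where "S = {w \<in> \<gamma> i. w [^] p \<in> ?K}"
    have "subgroup S G"
    proof (rule subgroupI)
      show "S \<noteq> {}" using L_one[of i] by (auto simp: S_def intro!: exI[of _ \<one>])
      show "S \<subseteq> carrier G" by (auto simp: S_def)
      show "inv a \<in> S" if "a \<in> S" for a using that by (auto simp: S_def nat_pow_inv L_inv)
      fix a b assume ab: "a \<in> S" "b \<in> S"
      then have cl: "a \<in> \<gamma> i" "b \<in> \<gamma> i" "a [^] p \<in> ?K" "b [^] p \<in> ?K" by (auto simp: S_def)
      have "inv (a [^] p) \<otimes> (a \<otimes> b) [^] p \<in> ?K"
        using L_cm_le[OF cl(1,2), of "Suc (Suc j)"] step.prems large cl by (intro K.pow_mult_mem) auto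
      from L_mult[OF cl(3) this] have "(a \<otimes> b) [^] p \<in> ?K" using cl(1,2) by simp
      then show "a \<otimes> b \<in> S" using cl L_mult by (simp add: S_def)
    qed
    moreover have low: "\<gamma> (Suc i) \<subseteq> S" using step L_Suc by (auto simp: S_def)
    moreover have "e (i - 1) \<in> S"
    proof -
      have e: "e (i - 2) \<in> \<gamma> (i - 1)" using e_mem[of "i - 2"] Suc_diff_Suc[of 1 i] i2 by (simp add: numeral_2_eq_2)
      have eq: "cm (e (i - 2)) g = e (i - 1)"
        using i2 iterated_cm.simps(2)[of y g "i - 2"] by (simp add: numeral_2_eq_2 Suc_diff_Suc del: iterated_cm.simps)
      have "iterated_cm (e (i - 2)) g k [^] p \<in> ?K" if "2 \<le> k" for k
        using step.prems that iterated_cm_mem[OF e, of k] i2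
        by (intro step.IH) (auto intro: L_antimonoD[of _ "i - 1 + k"])
      then have "cm (e (i - 2)) g [^] p \<otimes> iterated_cm (e (i - 2)) g p \<in> ?K"
        using step.prems e by (intro expansion_mod[OF e]) auto
      \<comment> \<open>Weight alone gives only \<open>\<gamma> (j + 1)\<close>. The last
        commutation with \<open>g\<close> starts in \<open>\<gamma> j\<close> and gains one level
        more.\<close>
      moreover have "iterated_cm (e (i - 2)) g p \<in> ?K"
      proof -
        have "iterated_cm (e (i - 2)) g (p - 1) \<in> \<gamma> j"
          using iterated_cm_mem[OF e, of "p - 1"] step.prems p_gt_2 large by (auto intro: L_antimonoD)
        from cm_g[OF this] show ?thesis using p_gt_2 by (cases p) auto
      qed
      ultimately have "e (i - 1) [^] p \<in> ?K"
        by (metis (no_types, opaque_lifting) eq K.m_inv_closed K.m_closed L_carrier inv_solve_right iterated_cm_closed g y nat_pow_closed)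
      then show ?thesis using e_mem[of "i - 1"] i2 by (simp add: S_def)
    qed
    ultimately have "\<gamma> i \<subseteq> S"
      using e_mem[of "i - 1"] e_notin[of "i - 1"] i2 ij j by (intro \<gamma>_generated[of i "e (i - 1)"]) auto
    then show ?thesis using step.prems by (auto simp: S_def)
  qed
qed

lemma large_False: False
proof -
  let ?K = "\<gamma> (Suc (Suc j))"
  interpret K: normal ?K G by (rule normal_\<gamma>)
  define u where "u = e (j - p)"
  have pj: "p < j" using large by simp
  have u: "u \<in> \<gamma> (Suc (j - p))" unfolding u_def by (rule e_mem)
  have ucl [simp]: "u \<in> carrier G" by (simp add: u_def)
  have e: "e (j - p - 1) \<in> \<gamma> (j - p)" using e_mem[of "j - p - 1"] pj by (simp add: Suc_diff_Suc)
  have eq: "cm (e (j - p - 1)) g = u"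
    using pj iterated_cm.simps(2)[of y g "j - p - 1"] by (simp add: u_def Suc_diff_Suc del: iterated_cm.simps)
  have eq': "iterated_cm (e (j - p - 1)) g p = e (j - 1)" using pj by (simp add: iterated_cm_add)
  have "iterated_cm (e (j - p - 1)) g k [^] p \<in> ?K" if "2 \<le> k" "k < p" for k
    using that iterated_cm_mem[OF e, of k] pj by (intro pow_p_mem_low[of "j - p + k"]) auto
  \<comment> \<open>One index below \<open>pow_p_mem_low\<close> the top term
    \<open>e (j - 1)\<close> survives, so \<open>u [^] p\<close> is its inverse modulo
    \<open>\<gamma> (j + 2)\<close>.\<close>
  from expansion_mod[OF e order_refl this] have up: "u [^] p \<otimes> e (j - 1) \<in> ?K"
    by (simp only: eq eq')
  have "cm (e (j - 1)) x \<in> ?K" if x [simp]: "x \<in> carrier G" for x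
  proof -
    have c: "cm u x \<in> \<gamma> (j - p + 2)" using cm_\<gamma>[OF u x] by simp
    \<comment> \<open>Conjugation by \<open>x\<close> changes \<open>u\<close> by a factor with
      trivial \<open>p\<close>-th power modulo \<open>\<gamma> (j + 2)\<close>, so
      \<open>u [^] p\<close> commutes with \<open>x\<close> there.\<close>
    have "inv (u [^] p) \<otimes> (u \<otimes> cm u x) [^] p \<in> ?K"
      using L_cm_le[OF u c, of "Suc (Suc j)"] large c pow_p_mem_low[OF _ _ c] by (intro K.pow_mult_mem) auto
    also have "inv (u [^] p) \<otimes> (u \<otimes> cm u x) [^] p = cm (u [^] p) x"
    proof -
      have "(u \<otimes> cm u x) [^] p = inv x \<otimes> u [^] p \<otimes> x"
        by (simp add: conj_pow flip: conj_eq_cm)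
      then show ?thesis by (simp add: cm_def m_assoc)
    qed
    finally have "u [^] p \<in> cmod (Suc (Suc j)) {x}" by (simp add: cmod_def)
    moreover have S: "subgroup (cmod (Suc (Suc j)) {x}) G" by (rule subgroup_cmod) simp
    moreover have "u [^] p \<otimes> e (j - 1) \<in> cmod (Suc (Suc j)) {x}"
      using up L_cm_le[OF up, of x 0] by (simp add: cmod_def)
    ultimately have "inv (u [^] p) \<otimes> (u [^] p \<otimes> e (j - 1)) \<in> cmod (Suc (Suc j)) {x}"
      using subgroup.m_closed subgroup.m_inv_closed by metis
    then show ?thesis by (simp add: cmod_def)
  qed
  then show False
    using not_all_cm_generator[OF j, of "e (j - 1)"] e_mem[of "j - 1"] e_notin[of "j - 1"] j by auto
qed

end

lemma j_le: "j \<le> 2 * p"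
  using large_False even_j by (cases "2 * p + 2 \<le> j") (auto elim!: evenE)

end

section \<open>Uniform elements and \<open>p\<close>-th powers\<close>

context maximal_class
begin

lemma card_proper_subgroup_le:
  assumes "subgroup H G" "H \<noteq> carrier G"
  shows "card H \<le> p ^ (n - 1)"
proof -
  obtain b where b: "card H = p ^ b" using card_subgroup[OF assms(1)] by blast
  have "b < n" using assms subgroup.subset[OF assms(1)]
    by (intro card_subgroup_less[OF subgroup_self _ b order_G]) auto
  then show ?thesis using p_gt_2 b by (simp add: power_increasing)
qed

text \<open>Proper subgroups have at most \<open>p ^ (n - 1)\<close> elements and share the
  identity, so \<open>p\<close> of them cover at most
  \<open>p * (p ^ (n - 1) - 1) + 1 < p ^ n\<close> elements.\<close>

lemma exists_outside_subgroups:
  assumes F: "\<And>t. t \<in> {1..p} \<Longrightarrow> subgroup (F t) G \<and> F t \<noteq> carrier G"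
  shows "\<exists>s\<in>carrier G. \<forall>t\<in>{1..p}. s \<notin> F t"
proof (rule ccontr)
  assume "\<not> ?thesis"
  then have "carrier G \<subseteq> insert \<one> (\<Union>t\<in>{1..p}. F t - {\<one>})" by auto
  moreover have fin: "finite (F t)" if "t \<in> {1..p}" for t using F[OF that] subgroup_finite by blast
  ultimately have "p ^ n \<le> card (insert \<one> (\<Union>t\<in>{1..p}. F t - {\<one>}))"
    unfolding order_G[symmetric] by (intro card_mono) auto
  also have "\<dots> \<le> Suc (card (\<Union>t\<in>{1..p}. F t - {\<one>}))" by (rule card_insert_le_m1) auto
  also have "card (\<Union>t\<in>{1..p}. F t - {\<one>}) \<le> (\<Sum>t\<in>{1..p}. card (F t - {\<one>}))"
    by (rule card_UN_le) simp
  also have "\<dots> \<le> (\<Sum>t\<in>{1..p}. p ^ (n - 1) - 1)"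
  proof (rule sum_mono)
    fix t assume t: "t \<in> {1..p}"
    have "card (F t - {\<one>}) = card (F t) - 1"
      using F[OF t] subgroup.one_closed by (intro card_Diff_singleton) auto
    then show "card (F t - {\<one>}) \<le> p ^ (n - 1) - 1"
      using F[OF t] card_proper_subgroup_le[of "F t"] by (simp add: diff_le_mono)
  qed
  also have "\<dots> = p ^ n - p"
    using n_gt_2 by (simp add: diff_mult_distrib2 flip: power_Suc)
  finally have "p ^ n \<le> Suc (p ^ n - p)" by simp
  moreover have "p \<le> p ^ n" using n_gt_2 p_gt_2 by (simp add: self_le_power)
  ultimately show False using p_gt_2 by linarith
qed

definition uniform :: "'a \<Rightarrow> bool" where
  "uniform s \<longleftrightarrow> s \<in> carrier G \<and> s \<notin> \<gamma> 2 \<and> (\<forall>j. 2 \<le> j \<longrightarrow> Suc j < n \<longrightarrow> s \<notin> centralizer2 j)"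

theorem exists_uniform: "\<exists>s. uniform s"
proof -
  \<comment> \<open>Only even indices up to \<open>2 * p\<close> can be the first centralized ones.
    Indices out of range are filled with \<open>\<gamma> 2\<close>; in either case
    \<open>F 1\<close> contains \<open>\<gamma> 2\<close>.\<close>
  define F where "F t = (if Suc (2 * t) < n then centralizer2 (2 * t) else \<gamma> 2)" for t
  have "\<gamma> 2 \<noteq> carrier G" using \<gamma>_strict[of 1] n_gt_2 by (auto simp: numeral_2_eq_2)
  then have "subgroup (F t) G \<and> F t \<noteq> carrier G" if "t \<in> {1..p}" for t
    using that subgroup_centralizer2[of "2 * t"] centralizer2_proper[of "2 * t"] subgroup_L[of 2]
    by (simp add: F_def)
  then have "\<exists>s\<in>carrier G. \<forall>t\<in>{1..p}. s \<notin> F t" by (rule exists_outside_subgroups)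
  then obtain s where s: "s \<in> carrier G" "\<And>t. t \<in> {1..p} \<Longrightarrow> s \<notin> F t" by blast
  have s2: "s \<notin> \<gamma> 2"
    using s(2)[of 1] p_gt_2 \<gamma>_2_centralizer2[of 2] by (auto simp: F_def split: if_splits)
  have "s \<notin> centralizer2 j" if "2 \<le> j" "Suc j < n" for j
    using that
  proof (induction j rule: less_induct)
    case (less j)
    show ?case
    proof
      assume "s \<in> centralizer2 j"
      with less s(1) s2 interpret first_centralizer G p n s j
        by unfold_locales auto
      obtain t where t: "j = 2 * t" using even_j by auto
      then have "t \<in> {1..p}" using j_le less.prems by auto
      with s(2)[OF this] \<open>s \<in> centralizer2 j\<close> less.prems t show False by (simp add: F_def)
    qed
  qed
  then show ?thesis using s s2 by (auto simp: uniform_def)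
qed

lemma uniform_pow_p:
  assumes "uniform s"
  shows "s [^] p \<in> \<gamma> (n - 1)"
  using assms n_gt_2 by (intro pow_p_mem_\<gamma>) (auto simp: uniform_def)

text \<open>Commutation with \<open>s\<close> maps \<open>\<gamma> i\<close> onto
  \<open>\<gamma> (i + 1)\<close> modulo \<open>\<gamma> (i + 2)\<close>: uniformity makes it
  nontrivial and the target section has order \<open>p\<close>. Descending induction absorbs the
  deeper error.\<close>

lemma uniform_conjugate:
  assumes s: "uniform s" and i: "1 \<le> i" "i < n" and "u \<in> \<gamma> (Suc i)"
  shows "\<exists>h\<in>\<gamma> i. s \<otimes> u = inv h \<otimes> s \<otimes> h"
proof -
  have scl [simp]: "s \<in> carrier G" using s by (simp add: uniform_def)
  have "i \<le> n - 1" using i by simp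
  then show ?thesis using i(1) \<open>u \<in> _\<close>
  proof (induction i arbitrary: u rule: inc_induct)
    case base
    then show ?case using n_gt_2 L_one by (auto intro!: bexI[of _ \<one>])
  next
    case (step i)
    have i: "1 \<le> i" "Suc i < n" using step.hyps step.prems by auto
    define V where "V = {u \<in> \<gamma> (Suc i). \<exists>h\<in>\<gamma> i. s \<otimes> u = inv h \<otimes> s \<otimes> h}"
    have low: "\<gamma> (Suc (Suc i)) \<subseteq> V"
    proof
      fix w assume w: "w \<in> \<gamma> (Suc (Suc i))"
      then obtain h where "h \<in> \<gamma> (Suc i)" "s \<otimes> w = inv h \<otimes> s \<otimes> h" using step.IH by auto
      then show "w \<in> V" using w L_antimonoD[of _ "Suc i" i] L_antimonoD[OF w, of "Suc i"] by (auto simp: V_def)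
    qed
    have V_mult: "v \<otimes> w \<in> V" if v: "v \<in> V" and w: "w \<in> \<gamma> (Suc (Suc i))" for v w
    proof -
      obtain h where h: "h \<in> \<gamma> i" "s \<otimes> v = inv h \<otimes> s \<otimes> h" "v \<in> \<gamma> (Suc i)" using v by (auto simp: V_def)
      have cl: "h \<in> carrier G" "v \<in> carrier G" "w \<in> carrier G" using h w by auto
      have "h \<otimes> w \<otimes> inv h \<in> \<gamma> (Suc (Suc i))" using \<gamma>_conj[OF w, of "inv h"] cl by simp
      then obtain k where k: "k \<in> \<gamma> i" "s \<otimes> (h \<otimes> w \<otimes> inv h) = inv k \<otimes> s \<otimes> k" using low by (auto simp: V_def)
      have kcl: "k \<in> carrier G" using k by auto
      have "s \<otimes> (v \<otimes> w) = inv h \<otimes> s \<otimes> h \<otimes> w" using h(2) cl by (simp flip: m_assoc)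
      also have "\<dots> = inv h \<otimes> (s \<otimes> (h \<otimes> w \<otimes> inv h)) \<otimes> h" using cl by (simp add: m_assoc)
      also have "\<dots> = inv (k \<otimes> h) \<otimes> s \<otimes> (k \<otimes> h)" using k(2) cl kcl by (simp add: word_simps)
      finally show ?thesis
        using h k L_mult L_antimonoD[OF w, of "Suc i"] by (auto simp: V_def intro!: bexI[of _ "k \<otimes> h"])
    qed
    have "subgroup V G"
    proof (rule subgroupI)
      show "V \<subseteq> carrier G" by (auto simp: V_def)
      show "V \<noteq> {}" using low L_one by blast
    next
      fix u assume "u \<in> V"
      then obtain h where h: "h \<in> \<gamma> i" "s \<otimes> u = inv h \<otimes> s \<otimes> h" and u: "u \<in> \<gamma> (Suc i)" by (auto simp: V_def)
      have cl: "h \<in> carrier G" "u \<in> carrier G" using h u by auto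
      define v where "v = h \<otimes> inv u \<otimes> inv h"
      have "s = h \<otimes> (s \<otimes> u) \<otimes> inv h" unfolding h(2) using cl by (simp add: m_assoc)
      then have "s \<otimes> v = h \<otimes> (s \<otimes> u) \<otimes> inv h \<otimes> v" using cl by (simp add: v_def)
      also have "\<dots> = inv (inv h) \<otimes> s \<otimes> inv h" using cl by (simp add: v_def m_assoc)
      finally have "v \<in> V"
        using h \<gamma>_conj[OF L_inv[OF u], of "inv h"] L_inv cl by (auto simp: V_def v_def intro!: bexI[of _ "inv h"])
      moreover have "cm (inv h) (inv u) \<in> \<gamma> (Suc (Suc i))"
        using L_inv h u step.prems by (intro L_cm_le[of _ i _ "Suc i"]) auto
      ultimately have "v \<otimes> cm (inv h) (inv u) \<in> V" by (rule V_mult)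
      moreover have "v \<otimes> cm (inv h) (inv u) = inv u" using cl by (simp add: v_def word_simps)
      ultimately show "inv u \<in> V" by simp
    next
      fix u u' assume uV: "u \<in> V" and u'V: "u' \<in> V"
      from uV obtain h where h: "h \<in> \<gamma> i" "s \<otimes> u = inv h \<otimes> s \<otimes> h" and u: "u \<in> \<gamma> (Suc i)" by (auto simp: V_def)
      from u'V obtain k where k: "k \<in> \<gamma> i" "s \<otimes> u' = inv k \<otimes> s \<otimes> k" and u': "u' \<in> \<gamma> (Suc i)" by (auto simp: V_def)
      have cl: "h \<in> carrier G" "u \<in> carrier G" "k \<in> carrier G" "u' \<in> carrier G" using h u k u' by auto
      \<comment> \<open>Conjugating \<open>s\<close> by \<open>h\<close> and then by
        \<open>k\<close> yields this product instead of \<open>u \<otimes> u'\<close>. The two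
        differ by commutators in \<open>\<gamma> (i + 2)\<close>, which \<open>V_mult\<close>
        absorbs.\<close>
      define v where "v = u' \<otimes> (inv k \<otimes> u \<otimes> k)"
      have "s \<otimes> v = (inv k \<otimes> s \<otimes> k) \<otimes> (inv k \<otimes> u \<otimes> k)" using k(2) cl by (simp add: v_def flip: m_assoc)
      also have "\<dots> = inv k \<otimes> (s \<otimes> u) \<otimes> k" using cl by (simp add: m_assoc)
      also have "\<dots> = inv (h \<otimes> k) \<otimes> s \<otimes> (h \<otimes> k)" unfolding h(2) using cl by (simp add: word_simps)
      finally have "v \<in> V"
        using L_mult[OF h(1) k(1)] L_mult[OF u' \<gamma>_conj[OF u cl(3)]] by (auto simp: V_def v_def)
      moreover have "cm k u \<otimes> cm u u' \<in> \<gamma> (Suc (Suc i))"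
        using step.prems by (intro L_mult L_cm_le[OF k(1) u] L_cm_le[OF u u']) auto
      ultimately have "v \<otimes> (cm k u \<otimes> cm u u') \<in> V" by (rule V_mult)
      moreover have "v \<otimes> (cm k u \<otimes> cm u u') = u \<otimes> u'" using cl by (simp add: v_def word_simps)
      ultimately show "u \<otimes> u' \<in> V" by simp
    qed
    moreover have "\<exists>c\<in>V. c \<notin> \<gamma> (Suc (Suc i))"
    proof -
      have "\<exists>h\<in>\<gamma> i. cm h s \<notin> \<gamma> (Suc (Suc i))"
      proof (cases "i = 1")
        case True
        obtain y where "y \<in> carrier G" "\<And>H. \<lbrakk>subgroup H G; \<gamma> 2 \<subseteq> H; s \<in> H; y \<in> H\<rbrakk> \<Longrightarrow> H = carrier G"
          using exists_cogenerator[of s] s by (auto simp: uniform_def)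
        then show ?thesis using cm_cogenerator_notin[of s y] True by (auto simp: numeral_3_eq_3)
      next
        case False
        have "\<gamma> (Suc i) \<subset> \<gamma> i" using step by (intro \<gamma>_strict) auto
        then obtain h where "h \<in> \<gamma> i" "h \<notin> \<gamma> (Suc i)" by blast
        then show ?thesis
          using cm_notin_if_not_centralizer2[of i h s] s i False by (auto simp: uniform_def)
      qed
      then obtain h where h: "h \<in> \<gamma> i" "cm h s \<notin> \<gamma> (Suc (Suc i))" by blast
      have hcl: "h \<in> carrier G" using h by auto
      have "cm s h \<in> \<gamma> (Suc i)" using cm_\<gamma>'[OF h(1)] by simp
      moreover have "s \<otimes> cm s h = inv h \<otimes> s \<otimes> h" using hcl by (simp flip: conj_eq_cm)
      ultimately show ?thesis using h cm_\<gamma>_swap[OF scl hcl] by (auto simp: V_def)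
    qed
    moreover have "V \<subseteq> \<gamma> (Suc i)" by (auto simp: V_def)
    ultimately have "\<gamma> (Suc i) \<subseteq> V"
      using \<gamma>_generated[of "Suc i" _ V] low i by auto
    then show ?case using step.prems by (auto simp: V_def)
  qed
qed

text \<open>The bound \<open>m < r + p\<close> puts the last coefficient of the collection formula
  into \<open>\<gamma> m\<close>; descending induction on \<open>r\<close> controls the powers from
  \<open>\<gamma> (Suc r)\<close>.\<close>

theorem pow_p_mem_\<gamma>_m:
  assumes "m \<le> n" "2 \<le> r" "m < r + p" "u \<in> \<gamma> r"
  shows "u [^] p \<in> \<gamma> m"
proof -
  obtain s where s: "uniform s" using exists_uniform by blast
  have scl [simp]: "s \<in> carrier G" using s by (simp add: uniform_def)
  have low: "u [^] p \<in> \<gamma> m" if "m \<le> r" "u \<in> \<gamma> r" for r u using that L_pow L_antimonoD by blast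
  have "u [^] p \<in> \<gamma> m" if "r \<le> m" "2 \<le> r" "m < r + p" "u \<in> \<gamma> r" for r u
    using that
  proof (induction r arbitrary: u rule: inc_induct)
    case base
    then show ?case using low by blast
  next
    case (step r)
    have ucl [simp]: "u \<in> carrier G" using step.prems by auto
    have "w [^] p \<in> \<gamma> m" if "w \<in> \<gamma> (Suc r)" for w using step that by auto
    moreover have "\<gamma> (r + p - 1) \<subseteq> \<gamma> m" using step.prems by (intro L_antimono) auto
    ultimately obtain h where h: "h \<in> \<gamma> m" "(s \<otimes> u) [^] p = s [^] p \<otimes> u [^] p \<otimes> h"
      using pow_prime_mult[OF prime_p, of r s u "\<gamma> m"] step.prems subgroup_L by auto
    have "u \<in> \<gamma> (Suc 1)" using step.prems by (auto intro: L_antimonoD)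
    then obtain k where k: "k \<in> carrier G" "s \<otimes> u = inv k \<otimes> s \<otimes> k"
      using uniform_conjugate[OF s, of 1 u] n_gt_2 by auto
    \<comment> \<open>\<open>s [^] p\<close> lies in \<open>\<gamma> (n - 1)\<close> and is central,
      so all conjugates of \<open>s\<close> have the same \<open>p\<close>-th power.\<close>
    have "cm (s [^] p) k \<in> \<gamma> n" using cm_\<gamma>[OF uniform_pow_p[OF s] k(1)] n_gt_2 by simp
    then have "(s \<otimes> u) [^] p = s [^] p" using k conj_eq_cm[of "s [^] p" k] by (simp add: conj_pow)
    then have "s [^] p \<otimes> (u [^] p \<otimes> h) = s [^] p" using h by (simp add: m_assoc L_carrier)
    then have "u [^] p \<otimes> h = \<one>" using h by (intro r_cancel_one'[THEN iffD1, of "s [^] p"]) auto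
    then have "u [^] p = inv h" using h by (metis L_carrier inv_equality inv_inv nat_pow_closed ucl)
    then show ?case using h L_inv by simp
  qed
  then show ?thesis using low[of r u] assms by (cases "r \<le> m") simp_all
qed

end

section \<open>Central extensions\<close>

locale central_cover = P: maximal_class P p n + E: central_series E
  for P :: "('a, 'm) monoid_scheme" and p n and E :: "('b, 'k) monoid_scheme" +
  fixes \<phi> :: "'b \<Rightarrow> 'a"
  assumes hom: "\<phi> \<in> hom E P" and surj: "\<phi> ` carrier E = carrier P"
    and central: "\<lbrakk>a \<in> carrier E; \<phi> a = \<one>\<^bsub>P\<^esub>; x \<in> carrier E\<rbrakk> \<Longrightarrow> a \<otimes>\<^bsub>E\<^esub> x = x \<otimes>\<^bsub>E\<^esub> a"

sublocale central_cover \<subseteq> \<phi>: group_hom E P \<phi>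
  using hom by unfold_locales

context central_cover
begin

lemma \<phi>_\<gamma>: "e \<in> E.\<gamma> i \<Longrightarrow> \<phi> e \<in> P.\<gamma> i"
proof (induction i arbitrary: e)
  case 0
  then show ?case by simp
next
  case (Suc i)
  show ?case
  proof (cases i)
    case 0
    with Suc.prems show ?thesis by simp
  next
    case (Suc k)
    let ?H = "{e \<in> carrier E. \<phi> e \<in> P.\<gamma> (Suc i)}"
    have "subgroup ?H E"
      by (rule E.subgroupI) (auto intro: P.L_mult P.L_inv exI[of _ "\<one>\<^bsub>E\<^esub>"])
    then have "E.\<gamma> (Suc i) \<subseteq> ?H"
    proof (rule E.\<gamma>_Suc_minimal)
      fix x y assume x: "x \<in> E.\<gamma> i" and y: "y \<in> carrier E"
      have "P.cm (\<phi> x) (\<phi> y) \<in> P.\<gamma> (Suc i)" using Suc.IH[OF x] y by (intro P.cm_\<gamma>) auto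
      then show "E.cm x y \<in> ?H" using x y by (simp add: \<phi>.hom_cm E.L_carrier)
    qed (use Suc in simp)
    with Suc.prems show ?thesis by blast
  qed
qed

lemma lift_\<gamma>: "g \<in> P.\<gamma> i \<Longrightarrow> \<exists>e\<in>E.\<gamma> i. \<phi> e = g"
proof (induction i arbitrary: g)
  case 0
  then have "g \<in> \<phi> ` carrier E" using surj by simp
  then show ?case by auto
next
  case (Suc i)
  show ?case
  proof (cases i)
    case 0
    with Suc.prems have "g \<in> \<phi> ` carrier E" using surj by simp
    with 0 show ?thesis by auto
  next
    case (Suc k)
    have "P.cm x y \<in> \<phi> ` E.\<gamma> (Suc i)" if x: "x \<in> P.\<gamma> i" and y: "y \<in> carrier P" for x y
    proof -
      obtain a b where ab: "a \<in> E.\<gamma> i" "\<phi> a = x" "b \<in> carrier E" "\<phi> b = y"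
        using Suc.IH[OF x] y surj by (metis imageE)
      then have "P.cm x y = \<phi> (E.cm a b)" by (auto simp: \<phi>.hom_cm)
      then show ?thesis using E.cm_\<gamma>[of a i b] ab by simp
    qed
    then have "P.\<gamma> (Suc i) \<subseteq> \<phi> ` E.\<gamma> (Suc i)"
      using Suc by (intro P.\<gamma>_Suc_minimal \<phi>.subgroup_img_is_subgroup E.subgroup_L) auto
    with Suc.prems show ?thesis by auto
  qed
qed

text \<open>Central factors do not change a commutator, so \<open>e\<close> may be replaced by a
  lift of \<open>\<phi> e\<close> taken from \<open>\<gamma> i\<close> of \<open>E\<close>.\<close>

lemma cm_mem_\<gamma>:
  assumes e: "e \<in> carrier E" "\<phi> e \<in> P.\<gamma> i" and x: "x \<in> carrier E"
  shows "E.cm e x \<in> E.\<gamma> (Suc i)"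
proof -
  obtain d where d: "d \<in> E.\<gamma> i" "\<phi> d = \<phi> e" using lift_\<gamma>[OF e(2)] by blast
  have dcl [simp]: "d \<in> carrier E" using d by auto
  define a where "a = inv\<^bsub>E\<^esub> d \<otimes>\<^bsub>E\<^esub> e"
  have acl [simp]: "a \<in> carrier E" using e by (simp add: a_def)
  have "\<phi> a = \<one>\<^bsub>P\<^esub>" using e d by (simp add: a_def)
  then have c: "a \<otimes>\<^bsub>E\<^esub> z = z \<otimes>\<^bsub>E\<^esub> a" if "z \<in> carrier E" for z using central[of a z] that by simp
  have "E.cm e x = E.cm (d \<otimes>\<^bsub>E\<^esub> a) x" using e by (simp add: a_def)
  also have "\<dots> = inv\<^bsub>E\<^esub> a \<otimes>\<^bsub>E\<^esub> E.cm d x \<otimes>\<^bsub>E\<^esub> a \<otimes>\<^bsub>E\<^esub> E.cm a x"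
    using x by (simp add: E.cm_mult_left)
  also have "E.cm a x = \<one>\<^bsub>E\<^esub>" using x c[OF x] by (simp add: E.cm_eq_one_iff)
  also have "inv\<^bsub>E\<^esub> a \<otimes>\<^bsub>E\<^esub> E.cm d x \<otimes>\<^bsub>E\<^esub> a \<otimes>\<^bsub>E\<^esub> \<one>\<^bsub>E\<^esub> = E.cm d x"
    using x by (simp add: E.m_assoc flip: c)
  finally show ?thesis using E.cm_\<gamma>[OF d(1) x] by simp
qed

lemma \<gamma>_Suc_n: "E.\<gamma> (Suc n) = {\<one>\<^bsub>E\<^esub>}"
proof -
  have "E.\<gamma> (Suc n) \<subseteq> {\<one>\<^bsub>E\<^esub>}"
  proof (rule E.\<gamma>_Suc_minimal[OF E.triv_subgroup])
    fix x y assume x: "x \<in> E.\<gamma> n" and y: "y \<in> carrier E"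
    have "\<phi> x = \<one>\<^bsub>P\<^esub>" using \<phi>_\<gamma>[OF x] by simp
    then show "E.cm x y \<in> {\<one>\<^bsub>E\<^esub>}" using central[of x y] x y by (simp add: E.cm_eq_one_iff E.L_carrier)
  qed (use P.n_gt_2 in simp)
  then show ?thesis using E.L_one by blast
qed

text \<open>The numerical bounds are those of \<open>pow_p_mem_\<gamma>_m\<close> at index
  \<open>j - 1\<close>, applied to the image of \<open>b\<close>. The gain from \<open>m\<close> to
  \<open>m + 1\<close> comes from commuting \<open>b [^] p\<close> with an element of
  \<open>E\<close>.\<close>

lemma pow_p_mem_\<gamma>_Suc:
  assumes "m \<le> n" "3 \<le> j" "m + 2 \<le> j + p" "v \<in> E.\<gamma> j"
  shows "v [^]\<^bsub>E\<^esub> p \<in> E.\<gamma> (Suc m)"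
proof -
  have low: "v [^]\<^bsub>E\<^esub> p \<in> E.\<gamma> (Suc m)" if "Suc m \<le> j" "v \<in> E.\<gamma> j" for v j
    using that E.L_pow E.L_antimonoD by blast
  have "v [^]\<^bsub>E\<^esub> p \<in> E.\<gamma> (Suc m)" if "j \<le> Suc m" "3 \<le> j" "m + 2 \<le> j + p" "v \<in> E.\<gamma> j" for j v
    using that
  proof (induction j arbitrary: v rule: inc_induct)
    case base
    then show ?case using low by blast
  next
    case (step j)
    let ?H = "E.\<gamma> (Suc m)"
    have power: "\<exists>h\<in>?H. (x \<otimes>\<^bsub>E\<^esub> u) [^]\<^bsub>E\<^esub> p = x [^]\<^bsub>E\<^esub> p \<otimes>\<^bsub>E\<^esub> u [^]\<^bsub>E\<^esub> p \<otimes>\<^bsub>E\<^esub> h"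
      if "x \<in> carrier E" "u \<in> E.\<gamma> j" for x u
    proof (rule E.pow_prime_mult[OF P.prime_p])
      show "1 \<le> j" using step.prems by simp
      show "E.\<gamma> (j + p - 1) \<subseteq> ?H" using step.prems by (intro E.L_antimono) auto
      show "w [^]\<^bsub>E\<^esub> p \<in> ?H" if "w \<in> E.\<gamma> (Suc j)" for w using step that by auto
    qed (use that E.subgroup_L in auto)
    define S where "S = {v \<in> E.\<gamma> j. v [^]\<^bsub>E\<^esub> p \<in> ?H}"
    have "subgroup S E"
    proof (rule E.subgroupI)
      show "S \<subseteq> carrier E" by (auto simp: S_def)
      show "S \<noteq> {}" using E.L_one[of j] by (auto simp: S_def intro!: exI[of _ "\<one>\<^bsub>E\<^esub>"])
      show "inv\<^bsub>E\<^esub> a \<in> S" if "a \<in> S" for a using that by (auto simp: S_def E.nat_pow_inv E.L_inv)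
      show "a \<otimes>\<^bsub>E\<^esub> b \<in> S" if "a \<in> S" "b \<in> S" for a b
        using that power[of a b] by (auto simp: S_def E.L_mult)
    qed
    then have "E.\<gamma> (Suc (j - 1)) \<subseteq> S"
    proof (rule E.\<gamma>_Suc_minimal)
      fix b x assume b: "b \<in> E.\<gamma> (j - 1)" and x [simp]: "x \<in> carrier E"
      have bcl [simp]: "b \<in> carrier E" using b by auto
      have v: "E.cm b x \<in> E.\<gamma> j" using E.cm_\<gamma>[OF b x] step.prems by simp
      then have vcl: "E.cm b x [^]\<^bsub>E\<^esub> p \<in> carrier E" by auto
      obtain h where h: "h \<in> ?H" "(b \<otimes>\<^bsub>E\<^esub> E.cm b x) [^]\<^bsub>E\<^esub> p
          = b [^]\<^bsub>E\<^esub> p \<otimes>\<^bsub>E\<^esub> E.cm b x [^]\<^bsub>E\<^esub> p \<otimes>\<^bsub>E\<^esub> h" using power[OF bcl v] by blast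
      have hcl: "h \<in> carrier E" using h by auto
      \<comment> \<open>The \<open>p\<close>-th power of a conjugate of \<open>b\<close> is computed
        twice: as a conjugate of \<open>b [^] p\<close> and by the collection formula.\<close>
      have "(b \<otimes>\<^bsub>E\<^esub> E.cm b x) [^]\<^bsub>E\<^esub> p = b [^]\<^bsub>E\<^esub> p \<otimes>\<^bsub>E\<^esub> E.cm (b [^]\<^bsub>E\<^esub> p) x"
        by (simp add: E.conj_pow flip: E.conj_eq_cm)
      then have "E.cm b x [^]\<^bsub>E\<^esub> p \<otimes>\<^bsub>E\<^esub> h = E.cm (b [^]\<^bsub>E\<^esub> p) x"
        using h hcl vcl by (simp add: E.m_assoc)
      moreover have "\<phi> b [^]\<^bsub>P\<^esub> p \<in> P.\<gamma> m"
        using step.prems assms(1) \<phi>_\<gamma>[OF b] by (intro P.pow_p_mem_\<gamma>_m[of m "j - 1"]) auto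
      then have "E.cm (b [^]\<^bsub>E\<^esub> p) x \<in> ?H" by (intro cm_mem_\<gamma>) (auto simp: \<phi>.hom_nat_pow)
      ultimately have "E.cm b x [^]\<^bsub>E\<^esub> p \<otimes>\<^bsub>E\<^esub> h \<otimes>\<^bsub>E\<^esub> inv\<^bsub>E\<^esub> h \<in> ?H"
        using h E.L_mult E.L_inv by simp
      then show "E.cm b x \<in> S" using v hcl vcl by (simp add: S_def E.m_assoc)
    qed (use step.prems in simp)
    then show ?case using step.prems by (auto simp: S_def)
  qed
  then show ?thesis using low[of j v] assms by (cases "j \<le> Suc m") simp_all
qed

text \<open>
  \<open>\<gamma> 2\<close> of \<open>E\<close> is cyclic modulo \<open>\<gamma> 3\<close> although \<open>E\<close> may need many generators, because only
  central ones are missing from a lift of a generating pair of \<open>P\<close>.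
\<close>

lemma mem_\<gamma>_3:
  assumes z: "z \<in> E.\<gamma> 2" and \<phi>z: "\<phi> z \<in> P.\<gamma> 3"
  shows "z \<in> E.\<gamma> 3"
proof -
  obtain s where s: "s \<in> carrier P" "s \<notin> P.\<gamma> 2"
    using P.\<gamma>_strict[of 1] P.n_gt_2 by (auto simp: numeral_2_eq_2)
  obtain y where y: "y \<in> carrier P"
    and all: "\<And>H. \<lbrakk>subgroup H P; P.\<gamma> 2 \<subseteq> H; s \<in> H; y \<in> H\<rbrakk> \<Longrightarrow> H = carrier P"
    by (rule P.exists_cogenerator[OF s]) blast
  obtain a b where a [simp]: "a \<in> carrier E" "\<phi> a = s" and b [simp]: "b \<in> carrier E" "\<phi> b = y"
    using s y surj by (metis imageE)
  define v where "v = E.cm b a"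
  have v2: "v \<in> E.\<gamma> 2" using E.cm_\<gamma>[of b 1 a] by (simp add: v_def numeral_2_eq_2)
  have vcl [simp]: "v \<in> carrier E" by (simp add: v_def)
  let ?K = "E.\<gamma> 3"
  have conj3: "g \<otimes>\<^bsub>E\<^esub> t \<otimes>\<^bsub>E\<^esub> inv\<^bsub>E\<^esub> g \<in> ?K" "inv\<^bsub>E\<^esub> g \<otimes>\<^bsub>E\<^esub> t \<otimes>\<^bsub>E\<^esub> g \<in> ?K"
    if "t \<in> ?K" "g \<in> carrier E" for t g
    using that E.\<gamma>_conj[of t 3 g] E.\<gamma>_conj[of t 3 "inv\<^bsub>E\<^esub> g"] by simp_all
  \<comment> \<open>The product of the cyclic group of \<open>v\<close> with
    \<open>\<gamma> 3\<close>, which turns out to be \<open>\<gamma> 2\<close>.\<close>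
  define S where "S = {v [^]\<^bsub>E\<^esub> (i::int) \<otimes>\<^bsub>E\<^esub> t | i t. t \<in> ?K}"
  have KS: "?K \<subseteq> S"
  proof
    fix t assume "t \<in> ?K"
    then show "t \<in> S" unfolding S_def by (intro CollectI exI[of _ 0] exI[of _ t]) auto
  qed
  have vS: "v \<in> S" unfolding S_def by (intro CollectI exI[of _ 1] exI[of _ "\<one>\<^bsub>E\<^esub>"]) auto
  have S2: "S \<subseteq> E.\<gamma> 2"
    using E.subgroup_int_pow_closed[OF E.subgroup_L v2] E.L_antimonoD[of _ 3 2]
    by (auto simp: S_def intro!: E.L_mult)
  have S: "subgroup S E"
  proof (rule E.subgroupI)
    show "S \<subseteq> carrier E" "S \<noteq> {}" using vS S2 by auto
    fix w assume "w \<in> S"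
    then obtain i t where w: "w = v [^]\<^bsub>E\<^esub> (i::int) \<otimes>\<^bsub>E\<^esub> t" "t \<in> ?K" by (auto simp: S_def)
    then have tcl: "t \<in> carrier E" by auto
    have "inv\<^bsub>E\<^esub> w = v [^]\<^bsub>E\<^esub> (- i) \<otimes>\<^bsub>E\<^esub> (v [^]\<^bsub>E\<^esub> i \<otimes>\<^bsub>E\<^esub> inv\<^bsub>E\<^esub> t \<otimes>\<^bsub>E\<^esub> inv\<^bsub>E\<^esub> (v [^]\<^bsub>E\<^esub> i))"
      using tcl by (simp add: w E.word_simps E.int_pow_neg)
    then show "inv\<^bsub>E\<^esub> w \<in> S" unfolding S_def using conj3(1)[OF E.L_inv[OF w(2)], of "v [^]\<^bsub>E\<^esub> i"] by auto
    fix w' assume "w' \<in> S"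
    then obtain i' t' where w': "w' = v [^]\<^bsub>E\<^esub> (i'::int) \<otimes>\<^bsub>E\<^esub> t'" "t' \<in> ?K" by (auto simp: S_def)
    then have tcl': "t' \<in> carrier E" by auto
    have "w \<otimes>\<^bsub>E\<^esub> w' = v [^]\<^bsub>E\<^esub> (i + i') \<otimes>\<^bsub>E\<^esub> ((inv\<^bsub>E\<^esub> (v [^]\<^bsub>E\<^esub> i') \<otimes>\<^bsub>E\<^esub> t \<otimes>\<^bsub>E\<^esub> v [^]\<^bsub>E\<^esub> i') \<otimes>\<^bsub>E\<^esub> t')"
      using tcl tcl' by (simp add: w w' E.m_assoc E.int_pow_mult)
    then show "w \<otimes>\<^bsub>E\<^esub> w' \<in> S"
      unfolding S_def using E.L_mult[OF conj3(2)[OF w(2)] w'(2), of "v [^]\<^bsub>E\<^esub> i'"] by auto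
  qed
  have normal_S: "S \<lhd> E"
  proof (rule E.normal_invI[OF S])
    fix g w assume g [simp]: "g \<in> carrier E" and w: "w \<in> S"
    then have w2: "w \<in> E.\<gamma> 2" and wcl: "w \<in> carrier E" using S2 by auto
    have "E.cm w (inv\<^bsub>E\<^esub> g) \<in> S" using E.cm_\<gamma>[OF w2, of "inv\<^bsub>E\<^esub> g"] KS by (auto simp: numeral_3_eq_3 numeral_2_eq_2)
    then show "g \<otimes>\<^bsub>E\<^esub> w \<otimes>\<^bsub>E\<^esub> inv\<^bsub>E\<^esub> g \<in> S"
      using subgroup.m_closed[OF S w] E.conj_eq_cm[of w "inv\<^bsub>E\<^esub> g"] wcl by simp
  qed
  \<comment> \<open>\<open>C\<close> contains \<open>a\<close>, \<open>b\<close> and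
    \<open>\<gamma> 2\<close>, so it maps onto \<open>P\<close>. The central kernel lies in
    \<open>C\<close> as well, which makes \<open>C\<close> all of \<open>E\<close>.\<close>
  have full: "c \<in> carrier E \<Longrightarrow> t \<in> T \<Longrightarrow> E.cm c t \<in> S"
    if T: "T \<subseteq> carrier E" and ab: "\<And>t. t \<in> T \<Longrightarrow> E.cm a t \<in> S" "\<And>t. t \<in> T \<Longrightarrow> E.cm b t \<in> S" for c t T
  proof -
    assume c: "c \<in> carrier E" and t: "t \<in> T"
    define C where "C = {w \<in> carrier E. \<forall>t\<in>T. E.cm w t \<in> S}"
    have C: "subgroup C E" unfolding C_def by (rule E.subgroup_cm_left[OF normal_S T])
    have g2: "E.\<gamma> 2 \<subseteq> C"
    proof
      fix w assume w: "w \<in> E.\<gamma> 2"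
      have "E.cm w t \<in> S" if "t \<in> T" for t
        using E.cm_\<gamma>[OF w, of t] KS T that by (auto simp: numeral_3_eq_3 numeral_2_eq_2)
      then show "w \<in> C" using w by (auto simp: C_def)
    qed
    have "P.\<gamma> 2 \<subseteq> \<phi> ` C" using lift_\<gamma>[of _ 2] g2 by blast
    moreover have "a \<in> C" "b \<in> C" using ab by (simp_all add: C_def)
    then have "s \<in> \<phi> ` C" "y \<in> \<phi> ` C" using a(2) b(2) by (metis imageI)+
    ultimately have "\<phi> ` C = carrier P" by (intro all \<phi>.subgroup_img_is_subgroup C)
    then have "\<phi> c \<in> \<phi> ` C" using c by simp
    then obtain d where d: "d \<in> C" "\<phi> d = \<phi> c" by auto
    have dcl: "d \<in> carrier E" using d by (simp add: C_def)
    have "E.cm (inv\<^bsub>E\<^esub> d \<otimes>\<^bsub>E\<^esub> c) t = \<one>\<^bsub>E\<^esub>" if "t \<in> T" for t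
      using central[of "inv\<^bsub>E\<^esub> d \<otimes>\<^bsub>E\<^esub> c" t] that T d dcl c by (auto simp: E.cm_eq_one_iff)
    then have "inv\<^bsub>E\<^esub> d \<otimes>\<^bsub>E\<^esub> c \<in> C" using dcl c subgroup.one_closed[OF S] by (simp add: C_def)
    from subgroup.m_closed[OF C d(1) this] have "c \<in> C" using dcl c by simp
    then show "E.cm c t \<in> S" using t by (simp add: C_def)
  qed
  have aa: "E.cm a a \<in> S" "E.cm b b \<in> S"
    using subgroup.one_closed[OF S] by (simp_all add: E.cm_eq_one_iff[THEN iffD2])
  have ab: "E.cm b a \<in> S" "E.cm a b \<in> S"
    using vS E.cm_swap[OF S, of b a] by (simp_all add: v_def)
  have A: "E.cm c a \<in> S" if "c \<in> carrier E" for c by (rule full[of "{a}" c a]) (use that aa ab in auto)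
  have B: "E.cm c b \<in> S" if "c \<in> carrier E" for c by (rule full[of "{b}" c b]) (use that aa ab in auto)
  have "E.cm c d \<in> S" if "c \<in> carrier E" "d \<in> carrier E" for c d
    by (rule full[of "carrier E"]) (use that A B in \<open>auto intro: E.cm_swap[OF S]\<close>)
  then have "E.\<gamma> (Suc 1) \<subseteq> S" by (intro E.\<gamma>_Suc_minimal S) auto
  with z obtain i t where zi: "z = v [^]\<^bsub>E\<^esub> (i::int) \<otimes>\<^bsub>E\<^esub> t" "t \<in> ?K"
    by (auto simp: S_def numeral_2_eq_2)
  have tcl: "t \<in> carrier E" using zi by auto
  have \<phi>v: "\<phi> v \<in> carrier P" "\<phi> v \<notin> P.\<gamma> 3" "\<phi> v \<in> P.\<gamma> 2"
    using P.cm_cogenerator_notin[OF s(1) y all] \<phi>_\<gamma>[OF v2] by (auto simp: v_def \<phi>.hom_cm)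
  have "\<phi> v [^]\<^bsub>P\<^esub> i = \<phi> z \<otimes>\<^bsub>P\<^esub> inv\<^bsub>P\<^esub> \<phi> t"
    using tcl \<phi>v by (simp add: zi \<phi>.hom_int_pow P.m_assoc)
  then have vi: "\<phi> v [^]\<^bsub>P\<^esub> i \<in> P.\<gamma> 3"
    using P.L_mult[OF \<phi>z P.L_inv[OF \<phi>_\<gamma>[OF zi(2)]]] by simp
  have vp: "\<phi> v [^]\<^bsub>P\<^esub> int p \<in> P.\<gamma> 3"
    using P.pow_p_\<gamma>[of 2 "\<phi> v"] \<phi>v P.n_gt_2 by (simp add: int_pow_int numeral_3_eq_3 numeral_2_eq_2)
  \<comment> \<open>The image of \<open>v\<close> has order \<open>p\<close> modulo
    \<open>\<gamma> 3\<close> of \<open>P\<close>, so a power vanishes there only if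
    \<open>p\<close> divides the exponent.\<close>
  have "int p dvd i"
  proof (rule ccontr)
    assume "\<not> int p dvd i"
    then have "coprime (int p) i" using P.prime_p by (intro prime_imp_coprime) auto
    then obtain k l where kl: "k * int p + l * i = 1" using bezout_int[of "int p" i] by auto
    have "(\<phi> v [^]\<^bsub>P\<^esub> int p) [^]\<^bsub>P\<^esub> k \<otimes>\<^bsub>P\<^esub> (\<phi> v [^]\<^bsub>P\<^esub> i) [^]\<^bsub>P\<^esub> l \<in> P.\<gamma> 3"
      by (intro P.L_mult P.subgroup_int_pow_closed[OF P.subgroup_L] vi vp)
    also have "(\<phi> v [^]\<^bsub>P\<^esub> int p) [^]\<^bsub>P\<^esub> k \<otimes>\<^bsub>P\<^esub> (\<phi> v [^]\<^bsub>P\<^esub> i) [^]\<^bsub>P\<^esub> l = \<phi> v"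
      using \<phi>v kl P.int_pow_mult[of "\<phi> v" "int p * k" "i * l"] by (simp add: P.int_pow_pow mult.commute)
    finally show False using \<phi>v by simp
  qed
  then obtain q where q: "i = int p * q" by auto
  \<comment> \<open>\<open>b [^] p\<close> maps into \<open>\<gamma> 2\<close> of \<open>P\<close>,
    so its commutator with \<open>a\<close> lies in \<open>\<gamma> 3\<close>. By the collection
    formula this commutator is \<open>v [^] p\<close> modulo \<open>\<gamma> 3\<close>.\<close>
  have "v [^]\<^bsub>E\<^esub> p \<in> ?K"
  proof -
    have 1: "E.\<gamma> (2 + p - 1) \<subseteq> ?K" using P.p_gt_2 by (intro E.L_antimono) auto
    obtain h where h: "h \<in> ?K" "(b \<otimes>\<^bsub>E\<^esub> v) [^]\<^bsub>E\<^esub> p = b [^]\<^bsub>E\<^esub> p \<otimes>\<^bsub>E\<^esub> v [^]\<^bsub>E\<^esub> p \<otimes>\<^bsub>E\<^esub> h"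
      by (rule E.pow_prime_mult[OF P.prime_p, of 2 b v ?K])
        (use v2 1 in \<open>auto intro: E.subgroup_L E.L_pow simp: numeral_3_eq_3 numeral_2_eq_2\<close>)
    have hcl: "h \<in> carrier E" using h by auto
    have "(b \<otimes>\<^bsub>E\<^esub> v) [^]\<^bsub>E\<^esub> p = b [^]\<^bsub>E\<^esub> p \<otimes>\<^bsub>E\<^esub> E.cm (b [^]\<^bsub>E\<^esub> p) a"
      by (simp add: v_def E.conj_pow flip: E.conj_eq_cm)
    then have "v [^]\<^bsub>E\<^esub> p \<otimes>\<^bsub>E\<^esub> h = E.cm (b [^]\<^bsub>E\<^esub> p) a" using h hcl by (simp add: E.m_assoc)
    moreover have "y [^]\<^bsub>P\<^esub> p \<in> P.\<gamma> 2" using P.pow_p_\<gamma>[of 1 y] y P.n_gt_2 by (simp add: numeral_2_eq_2)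
    then have "E.cm (b [^]\<^bsub>E\<^esub> p) a \<in> E.\<gamma> (Suc 2)" by (intro cm_mem_\<gamma>) (auto simp: \<phi>.hom_nat_pow)
    ultimately have "v [^]\<^bsub>E\<^esub> p \<otimes>\<^bsub>E\<^esub> h \<otimes>\<^bsub>E\<^esub> inv\<^bsub>E\<^esub> h \<in> ?K"
      using h E.L_mult E.L_inv by (simp add: numeral_3_eq_3 numeral_2_eq_2)
    then show ?thesis using hcl by (simp add: E.m_assoc)
  qed
  then have "(v [^]\<^bsub>E\<^esub> int p) [^]\<^bsub>E\<^esub> q \<in> ?K"
    using E.subgroup_int_pow_closed[OF E.subgroup_L] by (simp add: int_pow_int)
  then have "v [^]\<^bsub>E\<^esub> i \<in> ?K" by (simp add: q E.int_pow_pow)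
  then show ?thesis using zi E.L_mult by simp
qed

text \<open>Each factor \<open>p\<close> raises the reachable \<open>m\<close> by
  \<open>p - 1\<close>. Up to \<open>m = p + 1\<close> one factor is enough, since
  \<open>mem_\<gamma>_3\<close> already places \<open>z\<close> in \<open>\<gamma> 3\<close> of
  \<open>E\<close>; hence the count starts from \<open>m - 2\<close>.\<close>

lemma pow_mem_\<gamma>_Suc:
  assumes z: "z \<in> E.\<gamma> 2" and "3 \<le> m" "m \<le> n" "\<phi> z \<in> P.\<gamma> m" "m - 2 \<le> k * (p - 1)"
  shows "z [^]\<^bsub>E\<^esub> (p ^ k) \<in> E.\<gamma> (Suc m)"
  using assms(2-)
proof (induction k arbitrary: m)
  case 0
  then show ?case by simp
next
  case (Suc k)
  have zcl: "z \<in> carrier E" using z by auto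
  show ?case
  proof (cases "m \<le> p + 1")
    case True
    have "\<phi> z \<in> P.\<gamma> 3" using Suc.prems by (intro P.L_antimonoD[of _ m 3])
    then have "z [^]\<^bsub>E\<^esub> p \<in> E.\<gamma> (Suc m)"
      using True Suc.prems by (intro pow_p_mem_\<gamma>_Suc[of m 3] mem_\<gamma>_3 z) auto
    from E.L_pow[OF this, of "p ^ k"] show ?thesis using zcl by (simp add: E.nat_pow_pow)
  next
    case False
    define m' where "m' = m - (p - 1)"
    have m': "3 \<le> m'" "m' \<le> n" "m = m' + (p - 1)"
      using False Suc.prems P.p_gt_2 by (auto simp: m'_def)
    have "\<phi> z \<in> P.\<gamma> m'" using Suc.prems by (intro P.L_antimonoD[of _ m m']) (auto simp: m'_def)
    moreover have "m' - 2 \<le> k * (p - 1)" using Suc.prems(4) m' by simp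
    ultimately have "z [^]\<^bsub>E\<^esub> (p ^ k) \<in> E.\<gamma> (Suc m')" using Suc.IH m' by blast
    then have "(z [^]\<^bsub>E\<^esub> (p ^ k)) [^]\<^bsub>E\<^esub> p \<in> E.\<gamma> (Suc m)"
      using m' P.p_gt_2 Suc.prems by (intro pow_p_mem_\<gamma>_Suc[of m "Suc m'"]) auto
    then show ?thesis using zcl by (simp add: E.nat_pow_pow mult.commute)
  qed
qed

theorem pow_kernel_derived:
  assumes "z \<in> lower_central E 1" "\<phi> z = \<one>\<^bsub>P\<^esub>" "n - 2 \<le> k * (p - 1)"
  shows "z [^]\<^bsub>E\<^esub> (p ^ k) = \<one>\<^bsub>E\<^esub>"
  using pow_mem_\<gamma>_Suc[of z n k] assms P.n_gt_2 \<gamma>_Suc_n by (simp add: E.\<gamma>_def)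

end

section \<open>The universal cocycle and the bar complex\<close>

locale group_cocycle = G: group G + Q: comm_group Q
  for G :: "('a, 'm) monoid_scheme" and Q :: "('q, 'r) monoid_scheme" +
  fixes f :: "'a \<Rightarrow> 'a \<Rightarrow> 'q"
  assumes f_closed [simp, intro]: "\<lbrakk>g \<in> carrier G; h \<in> carrier G\<rbrakk> \<Longrightarrow> f g h \<in> carrier Q"
    and cocycle: "\<lbrakk>g \<in> carrier G; h \<in> carrier G; k \<in> carrier G\<rbrakk> \<Longrightarrow>
      f g h \<otimes>\<^bsub>Q\<^esub> f (g \<otimes>\<^bsub>G\<^esub> h) k = f h k \<otimes>\<^bsub>Q\<^esub> f g (h \<otimes>\<^bsub>G\<^esub> k)"
begin

text \<open>The cocycle is not normalised: its value at the pair of identities may be nontrivial and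
  enters the unit of \<open>E\<close>.\<close>

definition E :: "('q \<times> 'a) monoid" where
  "E = \<lparr>carrier = carrier Q \<times> carrier G,
    monoid.mult = (\<lambda>(a, g) (b, h). (a \<otimes>\<^bsub>Q\<^esub> b \<otimes>\<^bsub>Q\<^esub> f g h, g \<otimes>\<^bsub>G\<^esub> h)),
    one = (inv\<^bsub>Q\<^esub> f \<one>\<^bsub>G\<^esub> \<one>\<^bsub>G\<^esub>, \<one>\<^bsub>G\<^esub>)\<rparr>"

lemma carrier_E [simp]: "x \<in> carrier E \<longleftrightarrow> fst x \<in> carrier Q \<and> snd x \<in> carrier G"
  by (cases x) (simp add: E_def)

lemma mult_E [simp]: "(a, g) \<otimes>\<^bsub>E\<^esub> (b, h) = (a \<otimes>\<^bsub>Q\<^esub> b \<otimes>\<^bsub>Q\<^esub> f g h, g \<otimes>\<^bsub>G\<^esub> h)"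
  and one_E: "\<one>\<^bsub>E\<^esub> = (inv\<^bsub>Q\<^esub> f \<one>\<^bsub>G\<^esub> \<one>\<^bsub>G\<^esub>, \<one>\<^bsub>G\<^esub>)"
  by (simp_all add: E_def)

lemma f_one_left: "g \<in> carrier G \<Longrightarrow> f \<one>\<^bsub>G\<^esub> g = f \<one>\<^bsub>G\<^esub> \<one>\<^bsub>G\<^esub>"
  using cocycle[of "\<one>\<^bsub>G\<^esub>" "\<one>\<^bsub>G\<^esub>" g] by simp

lemma f_one_right: "g \<in> carrier G \<Longrightarrow> f g \<one>\<^bsub>G\<^esub> = f \<one>\<^bsub>G\<^esub> \<one>\<^bsub>G\<^esub>"
  using cocycle[of g "\<one>\<^bsub>G\<^esub>" "\<one>\<^bsub>G\<^esub>"] by simp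

lemma group_E: "group E"
proof (rule groupI)
  show "\<one>\<^bsub>E\<^esub> \<in> carrier E" by (simp add: one_E)
  fix x assume x: "x \<in> carrier E"
  obtain a g where [simp]: "x = (a, g)" by (cases x)
  have [simp]: "a \<in> carrier Q" "g \<in> carrier G" using x by auto
  show "\<one>\<^bsub>E\<^esub> \<otimes>\<^bsub>E\<^esub> x = x" by (simp add: one_E f_one_left[of g] Q.m_ac)
  let ?y = "(inv\<^bsub>Q\<^esub> a \<otimes>\<^bsub>Q\<^esub> inv\<^bsub>Q\<^esub> f (inv\<^bsub>G\<^esub> g) g \<otimes>\<^bsub>Q\<^esub> inv\<^bsub>Q\<^esub> f \<one>\<^bsub>G\<^esub> \<one>\<^bsub>G\<^esub>, inv\<^bsub>G\<^esub> g)"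
  have "b \<otimes>\<^bsub>Q\<^esub> (c \<otimes>\<^bsub>Q\<^esub> inv\<^bsub>Q\<^esub> b) = c" if "b \<in> carrier Q" "c \<in> carrier Q" for b c
    using that by (subst Q.m_lcomm) auto
  then have "?y \<otimes>\<^bsub>E\<^esub> x = \<one>\<^bsub>E\<^esub>" by (simp add: one_E Q.m_ac)
  then show "\<exists>y\<in>carrier E. y \<otimes>\<^bsub>E\<^esub> x = \<one>\<^bsub>E\<^esub>" by (intro bexI[of _ ?y]) auto
  fix y assume y: "y \<in> carrier E"
  obtain b h where [simp]: "y = (b, h)" by (cases y)
  have [simp]: "b \<in> carrier Q" "h \<in> carrier G" using y by auto
  show "x \<otimes>\<^bsub>E\<^esub> y \<in> carrier E" by simp
  fix z assume z: "z \<in> carrier E"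
  obtain c k where [simp]: "z = (c, k)" by (cases z)
  have [simp]: "c \<in> carrier Q" "k \<in> carrier G" using z by auto
  have "x \<otimes>\<^bsub>E\<^esub> y \<otimes>\<^bsub>E\<^esub> z = (a \<otimes>\<^bsub>Q\<^esub> b \<otimes>\<^bsub>Q\<^esub> c \<otimes>\<^bsub>Q\<^esub> (f g h \<otimes>\<^bsub>Q\<^esub> f (g \<otimes>\<^bsub>G\<^esub> h) k), g \<otimes>\<^bsub>G\<^esub> h \<otimes>\<^bsub>G\<^esub> k)"
    by (simp add: Q.m_ac)
  also have "\<dots> = x \<otimes>\<^bsub>E\<^esub> (y \<otimes>\<^bsub>E\<^esub> z)" by (subst cocycle) (simp_all add: Q.m_ac G.m_assoc)
  finally show "x \<otimes>\<^bsub>E\<^esub> y \<otimes>\<^bsub>E\<^esub> z = x \<otimes>\<^bsub>E\<^esub> (y \<otimes>\<^bsub>E\<^esub> z)" .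
qed

sublocale E: group E by (rule group_E)

lemma snd_hom: "snd \<in> hom E G"
  by (auto simp: hom_def)

lemma snd_surj: "snd ` carrier E = carrier G"
proof -
  have "g \<in> snd ` carrier E" if "g \<in> carrier G" for g
    using that by (intro image_eqI[of _ snd "(\<one>\<^bsub>Q\<^esub>, g)"]) auto
  then show ?thesis by auto
qed

lemma snd_kernel_central:
  "\<lbrakk>a \<in> carrier E; snd a = \<one>\<^bsub>G\<^esub>; x \<in> carrier E\<rbrakk> \<Longrightarrow> a \<otimes>\<^bsub>E\<^esub> x = x \<otimes>\<^bsub>E\<^esub> a"
  using f_one_left[of "snd x"] f_one_right[of "snd x"] by (cases a; cases x) (simp add: Q.m_ac)

text \<open>The correction cancels the cocycle value in a product, which makes
  \<open>\<iota>\<close> a homomorphism onto the kernel of \<open>snd\<close>.\<close>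

definition \<iota> :: "'q \<Rightarrow> 'q \<times> 'a" where
  "\<iota> a = (a \<otimes>\<^bsub>Q\<^esub> inv\<^bsub>Q\<^esub> f \<one>\<^bsub>G\<^esub> \<one>\<^bsub>G\<^esub>, \<one>\<^bsub>G\<^esub>)"

lemma \<iota>_hom: "\<iota> \<in> hom Q E"
  by (auto simp: hom_def \<iota>_def Q.m_ac)

sublocale \<iota>: group_hom Q E \<iota>
  using \<iota>_hom by unfold_locales

lemma \<iota>_eq_one_iff: "a \<in> carrier Q \<Longrightarrow> \<iota> a = \<one>\<^bsub>E\<^esub> \<longleftrightarrow> a = \<one>\<^bsub>Q\<^esub>"
  by (simp add: \<iota>_def one_E)

lemma section_mult:
  "\<lbrakk>g \<in> carrier G; h \<in> carrier G\<rbrakk> \<Longrightarrow>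
    (\<one>\<^bsub>Q\<^esub>, g) \<otimes>\<^bsub>E\<^esub> (\<one>\<^bsub>Q\<^esub>, h) = \<iota> (f g h) \<otimes>\<^bsub>E\<^esub> (\<one>\<^bsub>Q\<^esub>, g \<otimes>\<^bsub>G\<^esub> h)"
  using f_one_left[of "g \<otimes>\<^bsub>G\<^esub> h"] by (simp add: \<iota>_def Q.m_ac)

end

section \<open>Cycles and boundaries of the bar complex in degree 2\<close>

lemma length_3_iff: "length xs = 3 \<longleftrightarrow> (\<exists>g h k. xs = [g, h, k])"
  by (auto simp: numeral_3_eq_3 length_Suc_conv)

lemma length_2_iff: "length xs = 2 \<longleftrightarrow> (\<exists>g h. xs = [g, h])"
  by (auto simp: numeral_2_eq_2 length_Suc_conv)

lemma bar_boundary_add: "bar_boundary G (c + d) = bar_boundary G c + bar_boundary G d"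
  and bar_boundary_diff: "bar_boundary G (c - d) = bar_boundary G c - bar_boundary G d"
  and bar_boundary_0 [simp]: "bar_boundary G 0 = 0"
  by (simp_all add: bar_boundary_def frag_extend_add frag_extend_diff)

lemma keys_subset_add:
  "Poly_Mapping.keys x \<subseteq> S \<Longrightarrow> Poly_Mapping.keys y \<subseteq> S \<Longrightarrow> Poly_Mapping.keys (x + y) \<subseteq> S"
  by (rule order_trans[OF keys_add]) auto

lemma keys_subset_diff:
  "Poly_Mapping.keys x \<subseteq> S \<Longrightarrow> Poly_Mapping.keys y \<subseteq> S \<Longrightarrow> Poly_Mapping.keys (x - y) \<subseteq> S"
  by (rule order_trans[OF keys_diff]) auto

lemma carrier_bar_chain_group:
  "c \<in> carrier (bar_chain_group G n) \<longleftrightarrow> Poly_Mapping.keys c \<subseteq> {xs. length xs = n \<and> set xs \<subseteq> carrier G}"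
  by (simp add: bar_chain_group_def)

lemma bar_chain_group_simps [simp]:
  "monoid.mult (bar_chain_group G n) = (+)" "one (bar_chain_group G n) = 0" "comm_group (bar_chain_group G n)"
  "c [^]\<^bsub>bar_chain_group G n\<^esub> (k::nat) = frag_cmul (int k) c"
  by (simp_all add: bar_chain_group_def fun_eq_iff abelian_free_Abelian_group)

lemma group_bar_chain_group [simp]: "group (bar_chain_group G n)"
  by (simp add: bar_chain_group_def)

context group
begin

lemma bar_boundary_3_closed:
  assumes "c \<in> carrier (bar_chain_group G 3)"
  shows "bar_boundary G c \<in> carrier (bar_chain_group G 2) \<and> bar_boundary G (bar_boundary G c) = 0"
  using assms unfolding carrier_bar_chain_group
proof (induction c rule: free_Abelian_group_induct[consumes 1, case_names zero diff symbol])
  case (diff x y)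
  then show ?case by (simp add: bar_boundary_diff keys_subset_diff)
next
  case (symbol xs)
  then obtain g h k where xs: "xs = [g, h, k]" "g \<in> carrier G" "h \<in> carrier G" "k \<in> carrier G"
    by (auto simp: length_3_iff)
  show ?case
    using xs(2-) unfolding xs(1) bar_boundary_3
    by (intro conjI keys_subset_diff keys_subset_add)
      (auto simp: bar_boundary_diff bar_boundary_add bar_boundary_2 m_assoc)
qed simp

lemma bar_boundary_hom: "bar_boundary G \<in> hom (bar_chain_group G 3) (bar_chain_group G 2)"
  using bar_boundary_3_closed by (auto simp: hom_def bar_boundary_add)

lemma subgroup_bar_boundaries: "subgroup (bar_boundaries G 2) (bar_chain_group G 2)"
proof -
  interpret h: group_hom "bar_chain_group G 3" "bar_chain_group G 2" "bar_boundary G"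
    using bar_boundary_hom by (simp add: group_hom_def group_hom_axioms_def)
  show ?thesis using h.img_is_subgroup by (simp add: bar_boundaries_def numeral_3_eq_3 numeral_2_eq_2)
qed

lemma subgroup_bar_cycles: "subgroup (bar_cycles G n) (bar_chain_group G n)"
proof -
  interpret C: group "bar_chain_group G n" by simp
  have inv: "inv\<^bsub>bar_chain_group G n\<^esub> c = - c" if "c \<in> carrier (bar_chain_group G n)" for c
    using that by (simp add: bar_chain_group_def)
  show ?thesis
  proof (rule C.subgroupI)
    show "bar_cycles G n \<noteq> {}" using C.one_closed by (auto simp: bar_cycles_def intro!: exI[of _ 0])
    fix a assume a: "a \<in> bar_cycles G n"
    then show "inv\<^bsub>bar_chain_group G n\<^esub> a \<in> bar_cycles G n"
      using C.inv_closed[of a] bar_boundary_diff[of G 0 a] by (simp add: bar_cycles_def inv)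
    fix b assume "b \<in> bar_cycles G n"
    with a show "a \<otimes>\<^bsub>bar_chain_group G n\<^esub> b \<in> bar_cycles G n"
      using C.m_closed[of a b] by (simp add: bar_cycles_def bar_boundary_add)
  qed (auto simp: bar_cycles_def)
qed

text \<open>The universal target of 2-cocycles with trivial action. The classes of cycles in it form
  the Schur multiplier.\<close>

definition chain_quotient :: "('a list \<Rightarrow>\<^sub>0 int) set monoid" where
  "chain_quotient = bar_chain_group G 2 Mod bar_boundaries G 2"

definition chain_class :: "('a list \<Rightarrow>\<^sub>0 int) \<Rightarrow> ('a list \<Rightarrow>\<^sub>0 int) set" where
  "chain_class c = bar_boundaries G 2 #>\<^bsub>bar_chain_group G 2\<^esub> c"

lemma normal_bar_boundaries: "bar_boundaries G 2 \<lhd> bar_chain_group G 2"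
  by (rule comm_group.subgroup_imp_normal[OF _ subgroup_bar_boundaries]) simp

lemma chain_class_group_hom: "group_hom (bar_chain_group G 2) chain_quotient chain_class"
  using normal.group_hom_Mod[OF normal_bar_boundaries]
  unfolding chain_quotient_def chain_class_def[abs_def] .

lemma comm_group_chain_quotient: "comm_group chain_quotient"
  unfolding chain_quotient_def
  by (rule comm_group.abelian_FactGroup[OF _ subgroup_bar_boundaries]) simp

lemma chain_class_eq_one_iff:
  "c \<in> carrier (bar_chain_group G 2) \<Longrightarrow> chain_class c = \<one>\<^bsub>chain_quotient\<^esub> \<longleftrightarrow> c \<in> bar_boundaries G 2"
  using normal.rcos_one_if_mem[OF normal_bar_boundaries] normal.mem_if_rcos_one[OF normal_bar_boundaries]
  unfolding chain_quotient_def chain_class_def by blast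

lemma bar_symbol_closed:
  "g \<in> carrier G \<Longrightarrow> h \<in> carrier G \<Longrightarrow> frag_of [g, h] \<in> carrier (bar_chain_group G 2)"
  by (simp add: carrier_bar_chain_group)

text \<open>The two sides of the cocycle identity differ by the boundary of
  \<open>[g|h|k]\<close>.\<close>

lemma chain_cocycle: "group_cocycle G chain_quotient (\<lambda>g h. chain_class (frag_of [g, h]))"
proof -
  interpret c: group_hom "bar_chain_group G 2" chain_quotient chain_class by (rule chain_class_group_hom)
  interpret Q: comm_group chain_quotient by (rule comm_group_chain_quotient)
  show ?thesis
  proof (unfold_locales, goal_cases)
    case (1 g h)
    then show ?case by (intro c.hom_closed bar_symbol_closed)
  next
    case (2 g h k)
    let ?a = "frag_of [g, h] + frag_of [g \<otimes> h, k]" and ?b = "frag_of [h, k] + frag_of [g, h \<otimes> k]"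
    have "frag_of [g, h, k] \<in> carrier (bar_chain_group G 3)"
      using 2 by (simp add: carrier_bar_chain_group)
    then have "bar_boundary G (frag_of [g, h, k]) \<in> bar_boundaries G 2"
      by (auto simp: bar_boundaries_def numeral_3_eq_3 numeral_2_eq_2)
    then have d: "?b - ?a \<in> bar_boundaries G 2" by (simp add: bar_boundary_3 algebra_simps)
    then have dcl: "?b - ?a \<in> carrier (bar_chain_group G 2)"
      using subgroup.mem_carrier[OF subgroup_bar_boundaries] by blast
    have acl: "?a \<in> carrier (bar_chain_group G 2)"
      using c.G.m_closed[OF bar_symbol_closed bar_symbol_closed, of g h "g \<otimes> h" k] 2 by simp
    have "chain_class ?b = chain_class (?a + (?b - ?a))" by simp
    also have "\<dots> = chain_class ?a"
      using c.hom_mult[OF acl dcl] d chain_class_eq_one_iff[OF dcl] acl by simp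
    finally have "chain_class ?a = chain_class ?b" by simp
    moreover have "chain_class ?a = chain_class (frag_of [g, h]) \<otimes>\<^bsub>chain_quotient\<^esub> chain_class (frag_of [g \<otimes> h, k])"
      using c.hom_mult[OF bar_symbol_closed bar_symbol_closed, of g h "g \<otimes> h" k] 2 by simp
    moreover have "chain_class ?b = chain_class (frag_of [h, k]) \<otimes>\<^bsub>chain_quotient\<^esub> chain_class (frag_of [g, h \<otimes> k])"
      using c.hom_mult[OF bar_symbol_closed bar_symbol_closed, of h k g "h \<otimes> k"] 2 by simp
    ultimately show ?case by simp
  qed
qed

text \<open>Cycles modulo boundaries embed into chains modulo boundaries, so powers may be computed
  in \<open>chain_quotient\<close>.\<close>

lemma schur_multiplier_pow:
  assumes x: "x \<in> carrier (schur_multiplier G)"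
    and q: "\<And>c. c \<in> bar_cycles G 2 \<Longrightarrow> chain_class c [^]\<^bsub>chain_quotient\<^esub> (q::nat) = \<one>\<^bsub>chain_quotient\<^esub>"
  shows "x [^]\<^bsub>schur_multiplier G\<^esub> q = \<one>\<^bsub>schur_multiplier G\<^esub>"
proof -
  let ?C = "bar_chain_group G 2" and ?B = "bar_boundaries G 2" and ?Z = "bar_cycles G 2"
  let ?Z' = "subgroup_generated ?C ?Z"
  interpret C: comm_group ?C by simp
  interpret c: group_hom ?C chain_quotient chain_class by (rule chain_class_group_hom)
  have carrier_Z: "carrier ?Z' = ?Z"
    using subgroup.carrier_subgroup_generated_subgroup[OF subgroup_bar_cycles] .
  have BZ: "?B \<subseteq> ?Z"
    using bar_boundary_3_closed by (auto simp: bar_boundaries_def bar_cycles_def numeral_3_eq_3 numeral_2_eq_2)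
  interpret Z: comm_group ?Z' by (rule C.abelian_subgroup_generated[OF C.comm_group_axioms])
  have "subgroup ?B ?Z'"
    using subgroup_bar_boundaries BZ by (auto simp: C.subgroup_subgroup_generated_iff carrier_Z)
  then interpret B: normal ?B ?Z' by (rule Z.subgroup_imp_normal)
  have S: "schur_multiplier G = ?Z' Mod ?B" by (simp add: schur_multiplier_def integral_homology_group_def)
  obtain c where c: "c \<in> ?Z" "x = ?B #>\<^bsub>?Z'\<^esub> c"
    using x by (auto simp: S carrier_FactGroup carrier_Z)
  have ccl: "c \<in> carrier ?C" using c by (simp add: bar_cycles_def)
  have "chain_class (c [^]\<^bsub>?C\<^esub> q) = \<one>\<^bsub>chain_quotient\<^esub>"
    using q[OF c(1)] ccl by (simp add: c.hom_nat_pow del: bar_chain_group_simps)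
  then have "c [^]\<^bsub>?C\<^esub> q \<in> ?B"
    using ccl by (subst (asm) chain_class_eq_one_iff) (simp_all del: bar_chain_group_simps)
  then have "c [^]\<^bsub>?Z'\<^esub> q \<in> ?B" by (simp add: pow_subgroup_generated del: bar_chain_group_simps)
  then show ?thesis
    using c B.FactGroup_pow[of c q] B.rcos_one_if_mem by (simp add: S carrier_Z del: bar_chain_group_simps)
qed

end

section \<open>The extension by the universal cocycle\<close>

locale schur_cover = G: group G for G :: "('a, 'm) monoid_scheme"
begin

sublocale group_cocycle G G.chain_quotient "\<lambda>g h. G.chain_class (frag_of [g, h])"
  by (rule G.chain_cocycle)

text \<open>
  Modulo the derived subgroup, \<open>\<iota>\<close> of the symbol \<open>[g|h]\<close> equals \<open>s g \<cdot> s h \<cdot> (s (g h))\<^sup>-\<^sup>1\<close>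
  for the canonical section \<open>s\<close>. So \<open>\<iota>\<close> factors through the boundary map there and kills cycles.
\<close>

lemma cycle_derived:
  assumes c: "c \<in> bar_cycles G 2"
  shows "\<iota> (G.chain_class c) \<in> lower_central E (Suc 0)"
proof -
  let ?C = "bar_chain_group G 2" and ?S = "{xs. length xs = 1 \<and> set xs \<subseteq> carrier G}"
  let ?D = "lower_central E (Suc 0)"
  have D: "derived E (carrier E) = ?D" by (simp add: derived_def lower_central.simps)
  interpret D: normal ?D E by (rule E.normal_lower_central)
  interpret A: comm_group "E Mod ?D" using E.derived_quot_is_comm_group by (simp add: D)
  interpret \<pi>: group_hom E "E Mod ?D" "\<lambda>x. ?D #>\<^bsub>E\<^esub> x" by (rule D.group_hom_Mod)
  interpret c: group_hom ?C G.chain_quotient G.chain_class by (rule G.chain_class_group_hom)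
  let ?\<pi> = "\<lambda>x. ?D #>\<^bsub>E\<^esub> x"
  define s where "s g = (\<one>\<^bsub>G.chain_quotient\<^esub>, g)" for g :: 'a
  have scl [simp]: "s g \<in> carrier E" if "g \<in> carrier G" for g using that by (simp add: s_def)
  have "(\<lambda>xs. ?\<pi> (s (hd xs))) ` ?S \<subseteq> carrier (E Mod ?D)"
    by (auto simp: length_Suc_conv intro!: \<pi>.hom_closed simp del: carrier_E)
  \<comment> \<open>\<open>h\<close> extends the section, taken modulo the derived subgroup, to
    chains of degree 1; it exists because the quotient is abelian.\<close>
  then obtain h where h: "h \<in> hom (free_Abelian_group ?S) (E Mod ?D)"
    "\<And>xs. xs \<in> ?S \<Longrightarrow> h (frag_of xs) = ?\<pi> (s (hd xs))"
    by (rule A.free_Abelian_group_universal) blast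
  interpret h: group_hom "free_Abelian_group ?S" "E Mod ?D" h
    using h(1) by (simp add: group_hom_def group_hom_axioms_def A.is_group)
  have hs: "h (frag_of [g]) = ?\<pi> (s g)" if "g \<in> carrier G" for g using h(2)[of "[g]"] that by simp
  have h_diff: "h (x - y) = h x \<otimes>\<^bsub>E Mod ?D\<^esub> inv\<^bsub>E Mod ?D\<^esub> h y"
    if "Poly_Mapping.keys x \<subseteq> ?S" "Poly_Mapping.keys y \<subseteq> ?S" for x y
    using h.hom_mult[of x "- y"] h.hom_inv[of y] that by simp
  have main: "Poly_Mapping.keys (bar_boundary G c) \<subseteq> ?S \<and>
      c \<in> carrier ?C \<and> ?\<pi> (\<iota> (G.chain_class c)) = h (bar_boundary G c)" if "c \<in> carrier ?C" for c
    using that unfolding carrier_bar_chain_group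
  proof (induction c rule: free_Abelian_group_induct[consumes 1, case_names zero diff symbol])
    case zero
    show ?case using h.hom_one c.hom_one \<iota>.hom_one \<pi>.hom_one by simp
  next
    case (diff x y)
    then have cl: "x \<in> carrier ?C" "y \<in> carrier ?C" by (simp_all add: carrier_bar_chain_group)
    have "x - y = x \<otimes>\<^bsub>?C\<^esub> inv\<^bsub>?C\<^esub> y" using cl by (simp add: bar_chain_group_def)
    then have "G.chain_class (x - y) = G.chain_class x \<otimes>\<^bsub>G.chain_quotient\<^esub> inv\<^bsub>G.chain_quotient\<^esub> G.chain_class y"
      using cl by (simp del: bar_chain_group_simps)
    then have "?\<pi> (\<iota> (G.chain_class (x - y)))
        = ?\<pi> (\<iota> (G.chain_class x)) \<otimes>\<^bsub>E Mod ?D\<^esub> inv\<^bsub>E Mod ?D\<^esub> ?\<pi> (\<iota> (G.chain_class y))"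
      using cl by (simp del: mult_FactGroup carrier_E)
    with diff show ?case
      by (simp add: bar_boundary_diff h_diff keys_subset_diff del: mult_FactGroup)
  next
    case (symbol xs)
    then obtain g k where xs: "xs = [g, k]" and gk [simp]: "g \<in> carrier G" "k \<in> carrier G"
      by (auto simp: length_2_iff)
    let ?c = "\<iota> (G.chain_class (frag_of [g, k]))"
    have ccl: "?c \<in> carrier E" using gk by (intro \<iota>.hom_closed f_closed)
    have "?\<pi> (s g) \<otimes>\<^bsub>E Mod ?D\<^esub> ?\<pi> (s k) = ?\<pi> (s g \<otimes>\<^bsub>E\<^esub> s k)"
      by (rule \<pi>.hom_mult[symmetric]) (simp_all del: carrier_E)
    also have "s g \<otimes>\<^bsub>E\<^esub> s k = ?c \<otimes>\<^bsub>E\<^esub> s (g \<otimes>\<^bsub>G\<^esub> k)"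
      unfolding s_def by (rule section_mult[OF gk])
    also have "?\<pi> \<dots> = ?\<pi> ?c \<otimes>\<^bsub>E Mod ?D\<^esub> ?\<pi> (s (g \<otimes>\<^bsub>G\<^esub> k))"
      by (rule \<pi>.hom_mult[OF ccl]) (simp del: carrier_E)
    finally have eq: "?\<pi> (s g) \<otimes>\<^bsub>E Mod ?D\<^esub> ?\<pi> (s k) = ?\<pi> ?c \<otimes>\<^bsub>E Mod ?D\<^esub> ?\<pi> (s (g \<otimes>\<^bsub>G\<^esub> k))" .
    have "?\<pi> ?c = (?\<pi> (s g) \<otimes>\<^bsub>E Mod ?D\<^esub> ?\<pi> (s k)) \<otimes>\<^bsub>E Mod ?D\<^esub> inv\<^bsub>E Mod ?D\<^esub> ?\<pi> (s (g \<otimes>\<^bsub>G\<^esub> k))"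
    proof -
      have "?\<pi> ?c \<in> carrier (E Mod ?D)" "?\<pi> (s (g \<otimes>\<^bsub>G\<^esub> k)) \<in> carrier (E Mod ?D)"
        using ccl scl[of "g \<otimes>\<^bsub>G\<^esub> k"] \<pi>.hom_closed by simp_all
      then show ?thesis unfolding eq by (simp add: A.m_assoc del: mult_FactGroup one_FactGroup)
    qed
    moreover have "bar_boundary G (frag_of [g, k]) = frag_of [g] + frag_of [k] - frag_of [g \<otimes>\<^bsub>G\<^esub> k]"
      by (simp add: bar_boundary_2)
    moreover have "h (frag_of [g] + frag_of [k]) = ?\<pi> (s g) \<otimes>\<^bsub>E Mod ?D\<^esub> ?\<pi> (s k)"
      using h.hom_mult[of "frag_of [g]" "frag_of [k]"] by (simp add: hs del: mult_FactGroup)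
    moreover have sum: "Poly_Mapping.keys (frag_of [g] + frag_of [k]) \<subseteq> ?S" by (intro keys_subset_add) auto
    moreover have "Poly_Mapping.keys (frag_of [g] + frag_of [k] - frag_of [g \<otimes>\<^bsub>G\<^esub> k]) \<subseteq> ?S"
      by (intro keys_subset_diff sum) auto
    ultimately show ?case
      by (simp add: xs h_diff hs G.bar_symbol_closed del: mult_FactGroup)
  qed
  have "?\<pi> (\<iota> (G.chain_class c)) = h 0" using main[of c] c by (simp add: bar_cycles_def)
  also have "\<dots> = \<one>\<^bsub>E Mod ?D\<^esub>" using h.hom_one by simp
  finally show ?thesis
    using c by (intro D.mem_if_rcos_one \<iota>.hom_closed c.hom_closed) (auto simp: bar_cycles_def)
qed

end

theorem theorem2:
  fixes p n :: nat and P :: "('a, 'b) monoid_scheme"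
  assumes "prime p" and "p > 2" and "n > 2"
    and "maximal_class_group p n P"
  shows "group_exponent (schur_multiplier P)
           \<le> p ^ nat \<lceil>(real n - 2) / (real p - 1)\<rceil>"
proof -
  define k where "k = nat \<lceil>(real n - 2) / (real p - 1)\<rceil>"
  have "group P" using assms(4) by (simp add: maximal_class_group_def)
  then interpret P: maximal_class P p n
    using assms by (simp add: maximal_class_def central_series_def maximal_class_axioms_def)
  interpret C: schur_cover P by unfold_locales
  interpret central_cover P p n C.E snd
    using C.snd_hom C.snd_surj C.snd_kernel_central by unfold_locales auto
  \<comment> \<open>Clearing the denominator turns the ceiling into the inequality of natural
    numbers in \<open>pow_kernel_derived\<close>.\<close>
  have "(real n - 2) / (real p - 1) \<le> real k" unfolding k_def by linarith
  then have "real n - 2 \<le> real k * (real p - 1)" using assms(2) by (simp add: divide_le_eq)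
  also have "\<dots> = real (k * (p - 1))" using assms(2) by (simp add: of_nat_diff)
  finally have k: "n - 2 \<le> k * (p - 1)" using assms(3) by linarith
  have "P.chain_class c [^]\<^bsub>P.chain_quotient\<^esub> (p ^ k) = \<one>\<^bsub>P.chain_quotient\<^esub>"
    if c: "c \<in> bar_cycles P 2" for c
  proof -
    interpret c: group_hom "bar_chain_group P 2" P.chain_quotient P.chain_class
      by (rule P.chain_class_group_hom)
    have cl: "P.chain_class c \<in> carrier P.chain_quotient"
      using c by (intro c.hom_closed) (simp add: bar_cycles_def)
    \<comment> \<open>The class of a cycle lands both in the derived subgroup and in the kernel of
      \<open>snd\<close>; injectivity of \<open>\<iota>\<close> then carries the relation
      back.\<close>
    have "C.\<iota> (P.chain_class c) [^]\<^bsub>C.E\<^esub> (p ^ k) = \<one>\<^bsub>C.E\<^esub>"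
      using C.cycle_derived[OF c] k by (intro pow_kernel_derived) (simp_all add: C.\<iota>_def)
    then have "C.\<iota> (P.chain_class c [^]\<^bsub>P.chain_quotient\<^esub> (p ^ k)) = \<one>\<^bsub>C.E\<^esub>"
      using cl by (simp add: C.\<iota>.hom_nat_pow)
    then show ?thesis using cl by (simp add: C.\<iota>_eq_one_iff)
  qed
  then have "\<forall>x\<in>carrier (schur_multiplier P). x [^]\<^bsub>schur_multiplier P\<^esub> (p ^ k) = \<one>\<^bsub>schur_multiplier P\<^esub>"
    using P.schur_multiplier_pow by blast
  then have "group_exponent (schur_multiplier P) \<le> p ^ k"
    unfolding group_exponent_def using assms(2) by (intro Least_le) auto
  then show ?thesis by (simp add: k_def)
qed


end
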